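(* Let $m$ be a positive integer and $\mu\pmod m$ satisfy $F(\mu) \equiv 0 \pmod m$. Assume that the sublattice $I\subset\mathbb{Z}[\alpha]$ with basis \[ \begin{pmatrix} 1 & \cdots & 0 & -\mu^{d-1} \\ \vdots & \ddots & \vdots & \vdots \\ 0 & \cdots & 1 & -\mu \\ 0 & \cdots & 0 & m \end{pmatrix}\begin{pmatrix}\alpha^{d-1}\\ \vdots \\ \alpha \\ 1\end{pmatrix} \] (which is an ideal of $\mathbb{Z}[\alpha]$ with $\mathbb{Z}[\alpha]/I$ additively cyclic) is an invertible ideal of $\mathbb{Z}[\alpha]$. Then there is a unique $l$, $1\leq l \leq h^+(\alpha)$, and a unique double coset $U \gamma \Gamma_l \in U \backslash \Gamma / \Gamma_l$ such that \[ \begin{pmatrix} 1 & \cdots & 0 & -\mu^{d-1} \\ \vdots & \ddots & \vdots & \vdots \\ 0 & \cdots & 1 & -\mu \\ 0 & \cdots & 0 & m \end{pmatrix}\mathfrak{B}_1 = \gamma \mathfrak{B}_l \begin{pmatrix} \xi^{(1)} & \cdots & 0 \\ \vdots & \ddots & \vdots \\ 0 & \cdots & \xi^{(d)} \end{pmatrix} \] for some $\xi \in C^+_{r_1, r_2}$. Conversely, given $l$, $1\leq l \leq h^+(\alpha)$, and a double coset $U\gamma \Gamma_l \in U \backslash \Gamma / \Gamma_l$ for which there exists $\xi \in C^+_{r_1, r_2}$ such that \[ \gamma \mathfrak{B}_l \begin{pmatrix} \xi^{(1)} & \cdots & 0 \\ \vdots & \ddots & \vdots \\ 0 & \cdots &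 \xi^{(d)} \end{pmatrix} = \begin{pmatrix} 1 & \cdots & 0 & * \\ \vdots & \ddots & \vdots & * \\ 0 & \cdots & 1 & * \\ 0 & \cdots & 0 & * \end{pmatrix}\mathfrak{B}_1 , \] then necessarily \[ \gamma \mathfrak{B}_l \begin{pmatrix} \xi^{(1)} & \cdots & 0 \\ \vdots & \ddots & \vdots \\ 0 & \cdots & \xi^{(d)} \end{pmatrix} = \begin{pmatrix} 1 & \cdots & 0 & -\mu^{d-1} \\ \vdots & \ddots & \vdots & \vdots \\ 0 & \cdots & 1 & -\mu \\ 0 & \cdots & 0 & m \end{pmatrix}\mathfrak{B}_1 \] where $m$ is a positive integer and $\mu\pmod m$ satisfies $F(\mu) \equiv 0 \pmod m$. Moreover, such $m$ and $\mu \pmod m$, if they exist, are unique, and the sublattice with basis $\begin{pmatrix} 1 & \cdots & 0 & -\mu^{d-1} \\ \vdots & \ddots & \vdots & \vdots \\ 0 & \cdots & 1 & -\mu \\ 0 & \cdots & 0 & m \end{pmatrix}(\alpha^{d-1},\dots,\alpha,1)^T$ is an invertible ideal of $\mathbb{Z}[\alpha]$.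
   Context: Let $F(X) = X^d + a_1 X^{d-1} + \cdots + a_d \in \mathbb{Z}[X]$ be monic and irreducible, and let $\alpha$ be a root of $F$, identified with the vector in $\mathbb{C}^d$ of its $d$ complex embeddings $\alpha^{(1)},\dots,\alpha^{(d)}$. Let $r_1$ be the number of real embeddings and $r_2$ the number of conjugate pairs of complex embeddings ($d=r_1+2r_2$). $C_{r_1,r_2}\subset\mathbb{C}^d$ is the set of $\xi$ with $\xi^{(j)}\in\mathbb{R}$ for $1\le j\le r_1$ and $\xi^{(r_1+j+1)}=\overline{\xi^{(r_1+j)}}$ for odd $1\le j\le 2r_2$; $C^+_{r_1,r_2}$ is the subset where the real coordinates are positive. $h^+(\alpha)$ is the narrow class number of $\mathbb{Z}[\alpha]$; $I_l$, $1\le l\le h^+(\alpha)$, are fixed integral ideal representatives of the narrow ideal classes, with $I_1=\mathbb{Z}[\alpha]$, each with a fixed $\mathbb{Z}$-basis $\{\beta_{l1},\dots,\beta_{ld}\}$ (for $l=1$ this basis is $\{\alpha^{d-1},\dots,\alpha,1\}$). $\mathfrak{B}_l$ is the $d\times d$ matrix with $(i,j)$ entry $\beta_{li}^{(j)}$; so $\mathfrak{B}_1$ has rows $((\alpha^{(1)})^{d-k},\dots,(\alpha^{(d)})^{d-k})$, $k=1,\dots,d$. It is assumed $\mathrm{sign}\det\mathfrak{B}_l=\mathrm{sign}\det\mathfrak{B}_1$ for all $l$. $\Gamma=\mathrm{SL}(d,\mathbb{Z})$; $U$ is the subgroup of $\Gamma$ of matrices equal to the identity except for arbitrary integer entries in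 the first $d-1$ positions of the last column; $\Gamma_l=\Gamma\cap\{\mathfrak{B}_l\,\mathrm{diag}(\xi^{(1)},\dots,\xi^{(d)})\,\mathfrak{B}_l^{-1}:\xi\in C^+_{r_1,r_2}\}$.
   Formalization: The converse is stated for d ≥ 2 (it fails for d = 1), and its matrix identity is asserted for a suitable representative uγ, u ∈ U, of the double coset with the same ξ, since for d ≥ 3 it fails for an arbitrary representative γ. *)

theory Defs
  imports
    Complex_Main
    "HOL-Computational_Algebra.Polynomial_Factorial"
    "HOL-Number_Theory.Cong"
    "HOL-Algebra.QuotRing"
    "HOL-Algebra.Ideal_Product"
    "HOL-Algebra.Elementary_Groups"
    "Jordan_Normal_Form.Determinant"
begin

text \<open>
  Elements of the number field generated by \<open>\<alpha>\<close> are identified with the vectors of their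
  \<open>d\<close> complex embeddings; \<open>\<alpha>\<close> itself is the vector of the \<open>d\<close> roots of the defining
  polynomial, the \<open>r1\<close> real ones first, then the pairs of complex conjugates.
  Vector and matrix indices start at \<open>0\<close>.
\<close>

subsection \<open>The spaces of real and complex places\<close>

definition C_space :: "nat \<Rightarrow> nat \<Rightarrow> complex vec set" where
  "C_space r1 r2 = {\<xi> \<in> carrier_vec (r1 + 2 * r2).
     (\<forall>j<r1. \<xi> $ j \<in> \<real>) \<and>
     (\<forall>k<r2. \<xi> $ (r1 + 2 * k + 1) = cnj (\<xi> $ (r1 + 2 * k)))}"

definition C_plus :: "nat \<Rightarrow> nat \<Rightarrow> complex vec set" where
  "C_plus r1 r2 = {\<xi> \<in> C_space r1 r2. \<forall>j<r1. 0 < Re (\<xi> $ j)}"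

subsection \<open>The number field and its order\<close>

definition number_field :: "complex vec \<Rightarrow> complex vec ring" where
  "number_field \<alpha> =
     \<lparr> carrier = {vec (dim_vec \<alpha>) (\<lambda>j. poly (map_poly of_rat p) (\<alpha> $ j)) | p :: rat poly. True},
       mult = (\<lambda>x y. vec (dim_vec \<alpha>) (\<lambda>j. x $ j * y $ j)),
       one = vec (dim_vec \<alpha>) (\<lambda>j. 1),
       zero = 0\<^sub>v (dim_vec \<alpha>),
       add = (+) \<rparr>"

definition monogenic_order :: "complex vec \<Rightarrow> complex vec ring" where
  "monogenic_order \<alpha> = number_field \<alpha>
     \<lparr> carrier := {vec (dim_vec \<alpha>) (\<lambda>j. poly (map_poly of_int p) (\<alpha> $ j)) | p :: int poly. True} \<rparr>"

definition fractional_ideal :: "complex vec \<Rightarrow> complex vec set \<Rightarrow> bool" where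
  "fractional_ideal \<alpha> J \<longleftrightarrow>
     additive_subgroup J (number_field \<alpha>) \<and>
     J \<noteq> {\<zero>\<^bsub>number_field \<alpha>\<^esub>} \<and>
     (\<forall>a \<in> carrier (monogenic_order \<alpha>). \<forall>x \<in> J. a \<otimes>\<^bsub>number_field \<alpha>\<^esub> x \<in> J) \<and>
     (\<exists>a \<in> carrier (monogenic_order \<alpha>). a \<noteq> \<zero>\<^bsub>number_field \<alpha>\<^esub> \<and>
        (\<forall>x \<in> J. a \<otimes>\<^bsub>number_field \<alpha>\<^esub> x \<in> carrier (monogenic_order \<alpha>)))"

definition invertible_fractional_ideal :: "complex vec \<Rightarrow> complex vec set \<Rightarrow> bool" where
  "invertible_fractional_ideal \<alpha> J \<longleftrightarrow>
     fractional_ideal \<alpha> J \<and>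
     (\<exists>J'. fractional_ideal \<alpha> J' \<and>
        ideal_prod (number_field \<alpha>) J J' = carrier (monogenic_order \<alpha>))"

definition invertible_ideal :: "complex vec \<Rightarrow> complex vec set \<Rightarrow> bool" where
  "invertible_ideal \<alpha> J \<longleftrightarrow>
     ideal J (monogenic_order \<alpha>) \<and> invertible_fractional_ideal \<alpha> J"

subsection \<open>Narrow ideal classes\<close>

text \<open>
  The narrow class group is the group of invertible fractional ideals of the order modulo the
  principal ideals with a totally positive generator.  Coordinate \<open>j\<close> is a real
  embedding exactly if \<open>\<alpha> $ j\<close> is real.
\<close>

definition totally_positive :: "complex vec \<Rightarrow> complex vec \<Rightarrow> bool" where
  "totally_positive \<alpha> \<xi> \<longleftrightarrow>
     \<xi> \<in> carrier (number_field \<alpha>) \<and> \<xi> \<noteq> \<zero>\<^bsub>number_field \<alpha>\<^esub> \<and>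
     (\<forall>j<dim_vec \<alpha>. \<alpha> $ j \<in> \<real> \<longrightarrow> 0 < Re (\<xi> $ j))"

definition narrow_rel :: "complex vec \<Rightarrow> (complex vec set \<times> complex vec set) set" where
  "narrow_rel \<alpha> = {(J, J').
     invertible_fractional_ideal \<alpha> J \<and> invertible_fractional_ideal \<alpha> J' \<and>
     (\<exists>\<xi>. totally_positive \<alpha> \<xi> \<and> J' = (\<lambda>x. \<xi> \<otimes>\<^bsub>number_field \<alpha>\<^esub> x) ` J)}"

definition narrow_classes :: "complex vec \<Rightarrow> complex vec set set set" where
  "narrow_classes \<alpha> = {J. invertible_fractional_ideal \<alpha> J} // narrow_rel \<alpha>"

definition narrow_class_number :: "complex vec \<Rightarrow> nat" where
  "narrow_class_number \<alpha> = card (narrow_classes \<alpha>)"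

subsection \<open>Bases of lattices and their matrices\<close>

definition int_comb :: "nat \<Rightarrow> (nat \<Rightarrow> complex vec) \<Rightarrow> (nat \<Rightarrow> int) \<Rightarrow> complex vec" where
  "int_comb d b c = vec d (\<lambda>j. \<Sum>i<d. of_int (c i) * b i $ j)"

definition int_span :: "nat \<Rightarrow> (nat \<Rightarrow> complex vec) \<Rightarrow> complex vec set" where
  "int_span d b = range (int_comb d b)"

definition int_basis :: "nat \<Rightarrow> (nat \<Rightarrow> complex vec) \<Rightarrow> complex vec set \<Rightarrow> bool" where
  "int_basis d b J \<longleftrightarrow>
     (\<forall>i<d. b i \<in> carrier_vec d) \<and> int_span d b = J \<and>
     (\<forall>c. int_comb d b c = 0\<^sub>v d \<longrightarrow> (\<forall>i<d. c i = 0))"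

definition embedding_mat :: "nat \<Rightarrow> (nat \<Rightarrow> complex vec) \<Rightarrow> complex mat" where
  "embedding_mat d b = mat d d (\<lambda>(i, j). b i $ j)"

definition power_basis :: "complex vec \<Rightarrow> nat \<Rightarrow> complex vec" where
  "power_basis \<alpha> i = vec (dim_vec \<alpha>) (\<lambda>j. (\<alpha> $ j) ^ (dim_vec \<alpha> - 1 - i))"

subsection \<open>Integer matrices and double cosets\<close>

abbreviation cmat :: "int mat \<Rightarrow> complex mat" where
  "cmat \<equiv> map_mat of_int"

definition SL :: "nat \<Rightarrow> int mat set" where
  "SL d = {A \<in> carrier_mat d d. det A = 1}"

definition U_group :: "nat \<Rightarrow> int mat set" where
  "U_group d = {A \<in> SL d. \<forall>i<d. \<forall>j<d.
     \<not> (j = d - 1 \<and> i < d - 1) \<longrightarrow> A $$ (i, j) = 1\<^sub>m d $$ (i, j)}"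

definition unit_group :: "nat \<Rightarrow> nat \<Rightarrow> complex mat \<Rightarrow> int mat set" where
  "unit_group r1 r2 B = (let d = r1 + 2 * r2 in
     {A \<in> SL d. \<exists>\<xi> \<in> C_plus r1 r2. \<exists>Binv \<in> carrier_mat d d.
        inverts_mat B Binv \<and> inverts_mat Binv B \<and>
        cmat A = B * mat_diag d (\<lambda>j. \<xi> $ j) * Binv})"

definition double_cosets :: "nat \<Rightarrow> nat \<Rightarrow> complex mat \<Rightarrow> int mat set set" where
  "double_cosets r1 r2 B =
     {{u * \<gamma> * g | u g. u \<in> U_group (r1 + 2 * r2) \<and> g \<in> unit_group r1 r2 B} | \<gamma>.
        \<gamma> \<in> SL (r1 + 2 * r2)}"

definition root_mat :: "nat \<Rightarrow> int \<Rightarrow> int \<Rightarrow> int mat" where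
  "root_mat d m \<mu> = mat d d (\<lambda>(i, j).
     if j = d - 1 then (if i = d - 1 then m else - (\<mu> ^ (d - 1 - i)))
     else if i = j then 1 else 0)"

text \<open>
  Left multiplication of \<open>root_mat d m \<mu>\<close> by an element of \<open>U_group d\<close> changes the entries
  \<open>- \<mu> ^ k\<close> by arbitrary multiples of \<open>m\<close>, so the matrix identity singles out
  certain representatives of a double coset.  A double coset is related to \<open>\<mu>\<close> modulo
  \<open>m\<close> if the identity holds for some representative.
\<close>

definition parametrizes ::
  "nat \<Rightarrow> nat \<Rightarrow> complex mat \<Rightarrow> complex mat \<Rightarrow> int mat set \<Rightarrow> int \<Rightarrow> int \<Rightarrow> bool" where
  "parametrizes r1 r2 B1 B D m \<mu> \<longleftrightarrow> (let d = r1 + 2 * r2 in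
     \<exists>\<gamma> \<in> D. \<exists>\<xi> \<in> C_plus r1 r2.
       cmat (root_mat d m \<mu>) * B1 = cmat \<gamma> * B * mat_diag d (\<lambda>j. \<xi> $ j))"

definition root_lattice :: "complex vec \<Rightarrow> int \<Rightarrow> int \<Rightarrow> complex vec set" where
  "root_lattice \<alpha> m \<mu> = (let d = dim_vec \<alpha> in
     int_span d (\<lambda>i. int_comb d (power_basis \<alpha>) (\<lambda>j. root_mat d m \<mu> $$ (i, j))))"

end

theory Submission
  imports
    Defs
    "Jordan_Normal_Form.Char_Poly"
    "HOL-Algebra.Subrings"
begin

text \<open>
  Write \<open>L\<close> for the lattice of \<open>\<mu>\<close> modulo \<open>m\<close>; it consists of all \<open>p(\<alpha>)\<close> with
  \<open>p \<in> \<int>[X]\<close> and \<open>m\<close> dividing \<open>p(\<mu>)\<close>.  An identity between the matrix of \<open>L\<close> and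
  \<open>\<gamma> \<BB>\<^sub>l diag(\<xi>)\<close> says that \<open>L = \<xi> I\<^sub>l\<close>; then \<open>\<xi>\<close> is a quotient of elements of the
  field and totally positive, so \<open>L\<close> and \<open>I\<^sub>l\<close> lie in the same narrow class.  Conversely, if they lie
  in the same class, the transition matrix \<open>\<gamma>\<close> between the two bases has determinant \<open>\<plusminus>1\<close>, and
  comparing the signs of the determinants leaves only \<open>1\<close>.  Two such \<open>\<gamma>\<close> for the same \<open>l\<close> differ by a
  unit of the multiplier ring, that is, by an element of \<open>\<Gamma>\<^sub>l\<close>.

  For the converse, let \<open>c\<close> be the last diagonal entry of the given matrix.  The lattice contains the
  constant \<open>c\<close>, and all its constants are integer multiples of \<open>c\<close>.  Expanding \<open>\<alpha> c\<close> in the given basis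
  shows that \<open>c\<close> is an integer \<open>m\<close> and that the lattice contains \<open>\<alpha> - \<mu>\<close> for some integer \<open>\<mu>\<close>; hence
  it contains \<open>F(\<alpha>) - F(\<mu>) = - F(\<mu>)\<close> and every \<open>\<alpha>\<^sup>k - \<mu>\<^sup>k\<close>, which determines the last column
  modulo \<open>m\<close>.
\<close>

section \<open>The number field and its order\<close>

text \<open>Over the integers one cannot expect the value 1. A nonzero combination \<open>g\<close>
  of \<open>p\<close> and \<open>F\<close> of least degree divides a nonzero integer multiple of
  every combination, in particular of \<open>F\<close>. As \<open>F\<close> is prime, either
  \<open>F\<close> divides \<open>g\<close>, and then \<open>p\<close>, or \<open>g\<close> divides
  a nonzero constant and is itself constant.\<close>

lemma irreducible_bezout_int_poly:
  fixes F p :: "int poly"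
  assumes irr: "irreducible F" and nc: "degree F > 0" and ndvd: "\<not> F dvd p"
  obtains a b n where "n \<noteq> 0" "a * p + b * F = [:n:]"
proof -
  let ?S = "{g. g \<noteq> 0 \<and> (\<exists>a b. g = a * p + b * F)}"
  have F0: "F \<noteq> 0" using irr by auto
  have prime: "prime_elem F" using irr by (rule irreducible_imp_prime_elem)
  have "F = 0 * p + 1 * F" by simp
  then have "F \<in> ?S" using F0 by blast
  then obtain g where gS: "g \<in> ?S" and gmin: "\<And>h. h \<in> ?S \<Longrightarrow> degree g \<le> degree h"
    using ex_has_least_nat[of "\<lambda>g. g \<in> ?S" F degree] by blast
  from gS obtain a b where g0: "g \<noteq> 0" and g: "g = a * p + b * F" by auto
  have div: "\<exists>c q. c \<noteq> 0 \<and> smult c (u * p + v * F) = g * q" for u v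
  proof -
    from pseudo_mod(1)[OF g0, of "u * p + v * F"] obtain c q where c: "c \<noteq> 0"
      and eq: "smult c (u * p + v * F) = g * q + pseudo_mod (u * p + v * F) g" by auto
    \<comment> \<open>The pseudo-remainder is again a combination of \<open>p\<close> and
      \<open>F\<close>, so the minimal degree of \<open>g\<close> forces it to vanish.\<close>
    let ?r = "pseudo_mod (u * p + v * F) g"
    have "?r = smult c (u * p + v * F) - g * q" using eq by simp
    also have "\<dots> = (smult c u - a * q) * p + (smult c v - b * q) * F"
      unfolding g by (simp add: algebra_simps smult_add_right)
    finally have "?r = 0"
      using gmin[of ?r] pseudo_mod(2)[OF g0, of "u * p + v * F"] by fastforce
    with eq c show ?thesis by auto
  qed
  have not_const: "\<not> F dvd [:c:]" if "c \<noteq> 0" for c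
    using dvd_imp_degree_le[of F "[:c:]"] that nc by auto
  from div[of 0 1] obtain c q where c: "c \<noteq> 0" "smult c F = g * q" by auto
  have "F dvd g * q" using c(2) by (metis dvd_smult dvd_refl)
  then consider "F dvd g" | "F dvd q" using prime by (auto simp: prime_elem_dvd_mult_iff)
  then show ?thesis
  proof cases
    case 1
    from div[of 1 0] obtain c' q' where c': "c' \<noteq> 0" "smult c' p = g * q'" by auto
    then have "F dvd [:c':] * p" using 1 by simp
    then have "F dvd p" using prime not_const[OF c'(1)] by (simp only: prime_elem_dvd_mult_iff) simp
    with ndvd show ?thesis by simp
  next
    case 2
    then obtain q' where q': "q = F * q'" by auto
    have "F * [:c:] = F * (g * q')" using c(2) q' by (simp add: algebra_simps)
    then have "[:c:] = g * q'" using F0 by (metis mult_left_cancel)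
    then have "g dvd [:c:]" by simp
    then have "degree g = 0" using dvd_imp_degree_le[of g "[:c:]"] c(1) by auto
    then obtain n where n: "g = [:n:]" by (metis degree_eq_zeroE)
    with g0 have "n \<noteq> 0" by auto
    then show ?thesis using that[of n a b] g n by simp
  qed
qed

lemma clear_denominators_rat_poly:
  fixes p :: "rat poly"
  shows "\<exists>n (q :: int poly). n \<noteq> 0 \<and> smult (of_int n) p = map_poly of_int q"
proof (induction p)
  case 0
  show ?case by (rule exI[of _ 1], rule exI[of _ 0]) simp
next
  case (pCons a p)
  then obtain n q where n: "n \<noteq> 0" "smult (of_int n) p = map_poly of_int q" by auto
  obtain x y where y: "y > 0" and a: "a = of_int x / of_int y"
    by (metis quotient_of_denom_pos quotient_of_div surj_pair)
  have "smult (of_int (n * y)) (pCons a p) = map_poly of_int (pCons (n * x) (smult y q))"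
  proof -
    have "smult (of_int (n * y)) p = smult (of_int y) (smult (of_int n) p)" by (simp add: mult.commute)
    then show ?thesis using y a n(2) by (simp add: map_poly_pCons hom_distribs)
  qed
  then show ?case using y n(1) by (intro exI[of _ "n * y"] exI[of _ "pCons (n * x) (smult y q)"]) auto
qed

lemma map_poly_of_rat_of_int: "map_poly of_rat (map_poly of_int p) = (map_poly of_int p :: complex poly)"
  by (simp add: map_poly_map_poly o_def)

section \<open>Evaluation of integer polynomials at the roots\<close>

locale monogenic_field =
  fixes F :: "int poly" and \<alpha> :: "complex vec" and d :: nat
  assumes irreducible_F: "irreducible F" and monic_F: "lead_coeff F = 1"
    and degree_F: "degree F = d" and dim_alpha: "dim_vec \<alpha> = d"
    and roots: "bij_betw (\<lambda>j. \<alpha> $ j) {..<d} {z. poly (map_poly of_int F) z = 0}"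
begin

abbreviation "\<K> \<equiv> number_field \<alpha>"
abbreviation "\<O> \<equiv> monogenic_order \<alpha>"

text \<open>This is the homomorphism from Z[X] onto the order, with kernel generated by
  \<open>F\<close>. It reduces arithmetic in the field to integer polynomials and integer
  denominators.\<close>

definition ev :: "int poly \<Rightarrow> complex vec" where
  "ev p = vec d (\<lambda>j. poly (map_poly of_int p) (\<alpha> $ j))"

lemma d_pos: "d > 0"
proof (rule ccontr)
  assume "\<not> d > 0"
  then have "F = 1" using monic_F degree_F by (metis degree_eq_zeroE neq0_conv one_pCons coeff_pCons_0)
  then show False using irreducible_F by simp
qed

lemma root: "j < d \<Longrightarrow> poly (map_poly of_int F) (\<alpha> $ j) = 0"
  using roots by (auto simp: bij_betw_def)

lemma ev_carrier [simp]: "ev p \<in> carrier_vec d"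
  and dim_ev [simp]: "dim_vec (ev p) = d"
  by (auto simp: ev_def)

lemma ev_index [simp]: "j < d \<Longrightarrow> ev p $ j = poly (map_poly of_int p) (\<alpha> $ j)"
  by (simp add: ev_def)

lemma ev_0: "ev 0 = 0\<^sub>v d"
  and ev_add: "ev (p + q) = ev p + ev q"
  and ev_uminus: "ev (- p) = - ev p"
  by (auto simp: ev_def hom_distribs)

lemma ev_mult_index: "j < d \<Longrightarrow> ev (p * q) $ j = ev p $ j * ev q $ j"
  by (simp add: ev_def hom_distribs)

text \<open>If \<open>F\<close> does not divide \<open>p\<close>, the Bezout identity evaluated at a
  root of \<open>F\<close> turns a multiple of the value of \<open>p\<close> into a nonzero integer.
  One vanishing embedding therefore forces all of them to vanish.\<close>

lemma ev_vanishes_iff: "j < d \<Longrightarrow> ev p $ j = 0 \<longleftrightarrow> F dvd p"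
proof
  assume j: "j < d" and z: "ev p $ j = 0"
  show "F dvd p"
  proof (rule ccontr)
    assume "\<not> F dvd p"
    then obtain a b n where n: "n \<noteq> 0" and eq: "a * p + b * F = [:n:]"
      using irreducible_bezout_int_poly[OF irreducible_F] d_pos degree_F by metis
    have "ev (a * p + b * F) $ j = 0"
      using j z by (simp add: hom_distribs root)
    then show False using n j unfolding eq by (simp add: hom_distribs)
  qed
qed (auto simp: hom_distribs root)

lemma ev_eq_0_iff: "ev p = 0\<^sub>v d \<longleftrightarrow> F dvd p"
proof
  assume "ev p = 0\<^sub>v d"
  then show "F dvd p" using ev_vanishes_iff[OF d_pos, of p] d_pos by simp
qed (auto intro!: eq_vecI simp del: ev_index simp: ev_vanishes_iff)

text \<open>At the roots of \<open>F\<close> the identity \<open>a * p + b * F = [:n:]\<close>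
  becomes a(\<alpha>) p(\<alpha>) = n, which exhibits the inverse with an integer
  denominator.\<close>

lemma ev_inverse:
  assumes "ev p \<noteq> 0\<^sub>v d"
  obtains a n where "n \<noteq> 0" "\<And>j. j < d \<Longrightarrow> ev p $ j \<noteq> 0" "\<And>j. j < d \<Longrightarrow> inverse (ev p $ j) = ev a $ j / of_int n"
proof -
  have nd: "\<not> F dvd p" using assms ev_eq_0_iff by simp
  then obtain a b n where n: "n \<noteq> 0" and eq: "a * p + b * F = [:n:]"
    using irreducible_bezout_int_poly[OF irreducible_F] d_pos degree_F by metis
  have "ev a $ j * ev p $ j = of_int n" if "j < d" for j
  proof -
    have "ev (a * p + b * F) $ j = ev a $ j * ev p $ j"
      using that by (simp add: hom_distribs root)
    then show ?thesis unfolding eq using that by (simp add: hom_distribs)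
  qed
  then show thesis using n nd ev_vanishes_iff by (intro that[of n a]) (auto simp: field_simps)
qed

lemma carrier_order: "carrier \<O> = range ev"
  by (auto simp: monogenic_order_def number_field_def ev_def dim_alpha)

text \<open>Clearing denominators once lets all later closure arguments use \<open>ev\<close>
  instead of rational polynomials.\<close>

lemma carrier_field_iff:
  "x \<in> carrier \<K> \<longleftrightarrow> x \<in> carrier_vec d \<and> (\<exists>n p. n \<noteq> (0::int) \<and> (\<forall>j<d. x $ j = ev p $ j / of_int n))"
proof
  assume "x \<in> carrier \<K>"
  then obtain p where x: "x = vec d (\<lambda>j. poly (map_poly of_rat p) (\<alpha> $ j))"
    by (auto simp: number_field_def dim_alpha)
  obtain n q where n: "n \<noteq> 0" "smult (of_int n) p = map_poly of_int q"
    using clear_denominators_rat_poly by blast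
  have "map_poly of_int q = (map_poly of_rat (smult (of_int n) p) :: complex poly)"
    unfolding n(2) map_poly_of_rat_of_int ..
  also have "\<dots> = smult (of_int n) (map_poly of_rat p)" by (simp add: hom_distribs)
  finally have "map_poly of_int q = (smult (of_int n) (map_poly of_rat p) :: complex poly)" .
  then show "x \<in> carrier_vec d \<and> (\<exists>n p. n \<noteq> (0::int) \<and> (\<forall>j<d. x $ j = ev p $ j / of_int n))"
    using n(1) by (auto simp: x intro!: exI[of _ n] exI[of _ q])
next
  assume *: "x \<in> carrier_vec d \<and> (\<exists>n p. n \<noteq> (0::int) \<and> (\<forall>j<d. x $ j = ev p $ j / of_int n))"
  then obtain n p where n: "n \<noteq> (0::int)" and x: "\<And>j. j < d \<Longrightarrow> x $ j = ev p $ j / of_int n" by auto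
  have "x = vec d (\<lambda>j. poly (map_poly of_rat (smult (1 / of_int n) (map_poly of_int p))) (\<alpha> $ j))"
    using * by (auto simp: x hom_distribs map_poly_of_rat_of_int of_rat_divide)
  then show "x \<in> carrier \<K>" by (auto simp: number_field_def dim_alpha)
qed

lemma carrier_fieldI:
  "x \<in> carrier_vec d \<Longrightarrow> n \<noteq> (0::int) \<Longrightarrow> (\<And>j. j < d \<Longrightarrow> x $ j = ev p $ j / of_int n) \<Longrightarrow> x \<in> carrier \<K>"
  by (auto simp: carrier_field_iff)

lemma carrier_fieldE:
  assumes "x \<in> carrier \<K>"
  obtains n p where "n \<noteq> (0::int)" "\<And>j. j < d \<Longrightarrow> x $ j = ev p $ j / of_int n"
  using assms by (auto simp: carrier_field_iff)

lemma field_carrier_vec: "x \<in> carrier \<K> \<Longrightarrow> x \<in> carrier_vec d"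
  by (simp add: carrier_field_iff)

lemma order_subset_field: "carrier \<O> \<subseteq> carrier \<K>"
  by (auto simp: carrier_order intro!: carrier_fieldI[where n = 1])

section \<open>Ring structure of the field and of its order\<close>

definition pmul :: "complex vec \<Rightarrow> complex vec \<Rightarrow> complex vec" where
  "pmul x y = vec d (\<lambda>j. x $ j * y $ j)"

lemma pmul_carrier [simp]: "pmul x y \<in> carrier_vec d"
  and dim_pmul [simp]: "dim_vec (pmul x y) = d"
  and pmul_index [simp]: "j < d \<Longrightarrow> pmul x y $ j = x $ j * y $ j"
  by (auto simp: pmul_def)

lemma pmul_commute: "pmul x y = pmul y x"
  and pmul_assoc: "pmul (pmul x y) z = pmul x (pmul y z)"
  and pmul_left_commute: "pmul x (pmul y z) = pmul y (pmul x z)"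
  by (auto simp: mult_ac)

lemma pmul_add: "y \<in> carrier_vec d \<Longrightarrow> z \<in> carrier_vec d \<Longrightarrow> pmul x (y + z) = pmul x y + pmul x z"
  and pmul_uminus: "y \<in> carrier_vec d \<Longrightarrow> pmul x (- y) = - pmul x y"
  and pmul_0: "pmul x (0\<^sub>v d) = 0\<^sub>v d"
  by (auto simp: algebra_simps)

lemma ev_mult: "ev (p * q) = pmul (ev p) (ev q)"
  by (auto simp: ev_mult_index simp del: ev_index)

lemma mult_field: "x \<otimes>\<^bsub>\<K>\<^esub> y = pmul x y"
  and one_field: "\<one>\<^bsub>\<K>\<^esub> = vec d (\<lambda>j. 1)"
  and zero_field: "\<zero>\<^bsub>\<K>\<^esub> = 0\<^sub>v d"
  and add_field: "x \<oplus>\<^bsub>\<K>\<^esub> y = x + y"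
  by (auto simp: number_field_def dim_alpha pmul_def)

lemma mult_order: "x \<otimes>\<^bsub>\<O>\<^esub> y = pmul x y"
  and one_order: "\<one>\<^bsub>\<O>\<^esub> = vec d (\<lambda>j. 1)"
  and zero_order: "\<zero>\<^bsub>\<O>\<^esub> = 0\<^sub>v d"
  and add_order: "x \<oplus>\<^bsub>\<O>\<^esub> y = x + y"
  by (auto simp: monogenic_order_def number_field_def dim_alpha pmul_def)

lemmas field_ops = mult_field one_field zero_field add_field
lemmas order_ops = mult_order one_order zero_order add_order

lemma field_closed:
  assumes "x \<in> carrier \<K>" "y \<in> carrier \<K>"
  shows "x + y \<in> carrier \<K>" "pmul x y \<in> carrier \<K>" "- x \<in> carrier \<K>"
proof -
  note xy = assms[THEN field_carrier_vec]
  obtain n p where n: "n \<noteq> 0" and x: "\<And>j. j < d \<Longrightarrow> x $ j = ev p $ j / of_int n"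
    using assms(1) carrier_fieldE by blast
  obtain k q where k: "k \<noteq> 0" and y: "\<And>j. j < d \<Longrightarrow> y $ j = ev q $ j / of_int k"
    using assms(2) carrier_fieldE by blast
  show "x + y \<in> carrier \<K>"
    by (rule carrier_fieldI[of _ "n * k" "smult k p + smult n q"])
      (use xy n k in \<open>auto simp: x y hom_distribs field_simps\<close>)
  show "pmul x y \<in> carrier \<K>"
    by (rule carrier_fieldI[of _ "n * k" "p * q"])
      (use xy n k in \<open>auto simp: x y hom_distribs field_simps\<close>)
  show "- x \<in> carrier \<K>"
    by (rule carrier_fieldI[of _ n "- p"]) (use xy n in \<open>auto simp: x hom_distribs\<close>)
qed

lemma zero_in_field: "0\<^sub>v d \<in> carrier \<K>"
  and one_in_field: "vec d (\<lambda>j. 1) \<in> carrier \<K>"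
  by (rule carrier_fieldI[of _ 1 0], auto) (rule carrier_fieldI[of _ 1 1], auto)

text \<open>The embeddings of an element vanish all together or not at all, so inverting coordinates
  is legitimate. The inverse of p(\<alpha>)/n is n a(\<alpha>)/k when that of p(\<alpha>) is
  a(\<alpha>)/k.\<close>

lemma field_inverse:
  assumes "x \<in> carrier \<K>" "x \<noteq> 0\<^sub>v d"
  shows "vec d (\<lambda>j. inverse (x $ j)) \<in> carrier \<K>" and "j < d \<Longrightarrow> x $ j \<noteq> 0"
proof -
  obtain n p where n: "n \<noteq> 0" and x: "\<And>j. j < d \<Longrightarrow> x $ j = ev p $ j / of_int n"
    using assms(1) carrier_fieldE by blast
  have "ev p \<noteq> 0\<^sub>v d"
  proof
    assume "ev p = 0\<^sub>v d"
    then have "x $ j = 0" if "j < d" for j using x[OF that] that by simp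
    then have "x = 0\<^sub>v d" using field_carrier_vec[OF assms(1)] by (intro eq_vecI) auto
    with assms(2) show False ..
  qed
  from ev_inverse[OF this] obtain a k where k: "k \<noteq> 0" and nz: "\<And>j. j < d \<Longrightarrow> ev p $ j \<noteq> 0"
    and inv: "\<And>j. j < d \<Longrightarrow> inverse (ev p $ j) = ev a $ j / of_int k" by metis
  show "vec d (\<lambda>j. inverse (x $ j)) \<in> carrier \<K>"
  proof (rule carrier_fieldI[of _ k "smult n a"])
    fix j assume j: "j < d"
    have "inverse (x $ j) = of_int n * inverse (ev p $ j)" using x[OF j] by (simp add: field_simps)
    also have "\<dots> = ev (smult n a) $ j / of_int k" using j inv[OF j] by (simp add: hom_distribs)
    finally show "vec d (\<lambda>j. inverse (x $ j)) $ j = ev (smult n a) $ j / of_int k" using j by simp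
  qed (use k in auto)
  show "x $ j \<noteq> 0" if "j < d" for j using x[OF that] nz[OF that] n by simp
qed

lemma cring_field: "cring \<K>"
proof (rule cringI)
  show "abelian_group \<K>"
  proof (rule abelian_groupI)
    fix x assume x: "x \<in> carrier \<K>"
    show "\<exists>y\<in>carrier \<K>. y \<oplus>\<^bsub>\<K>\<^esub> x = \<zero>\<^bsub>\<K>\<^esub>"
      using field_carrier_vec[OF x] field_closed(3)[OF x x]
      by (intro bexI[of _ "- x"]) (auto simp: field_ops)
  qed (auto simp: field_ops field_closed zero_in_field dest!: field_carrier_vec
      intro: comm_add_vec assoc_add_vec)
  show "Group.comm_monoid \<K>"
    by (rule comm_monoidI) (auto simp: field_ops field_closed one_in_field mult.commute
        dest!: field_carrier_vec)
qed (auto simp: field_ops algebra_simps dest!: field_carrier_vec)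

lemma uminus_field: "x \<in> carrier \<K> \<Longrightarrow> \<ominus>\<^bsub>\<K>\<^esub> x = - x"
proof -
  assume x: "x \<in> carrier \<K>"
  interpret cring \<K> by (rule cring_field)
  have "- x \<oplus>\<^bsub>\<K>\<^esub> x = \<zero>\<^bsub>\<K>\<^esub>" using field_carrier_vec[OF x] by (auto simp: field_ops)
  then show ?thesis using minus_equality[of "- x" x] field_closed(3)[OF x x] x by simp
qed

lemma cring_order: "cring \<O>"
proof -
  interpret K: cring \<K> by (rule cring_field)
  have "subring (range ev) \<K>"
  proof (rule K.subringI)
    show "range ev \<subseteq> carrier \<K>" using order_subset_field carrier_order by simp
    show "\<one>\<^bsub>\<K>\<^esub> \<in> range ev" by (rule range_eqI[of _ _ 1]) (auto simp: field_ops)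
    show "\<ominus>\<^bsub>\<K>\<^esub> h \<in> range ev" if "h \<in> range ev" for h
      using that order_subset_field carrier_order by (auto simp: uminus_field simp flip: ev_uminus)
    fix x y assume "x \<in> range ev" "y \<in> range ev"
    then obtain p q where [simp]: "x = ev p" "y = ev q" by auto
    show "x \<otimes>\<^bsub>\<K>\<^esub> y \<in> range ev"
      by (rule range_eqI[of _ _ "p * q"]) (auto simp: field_ops hom_distribs)
    show "x \<oplus>\<^bsub>\<K>\<^esub> y \<in> range ev" by (simp add: field_ops flip: ev_add)
  qed
  then have "subcring (range ev) \<K>" by (rule K.subcringI')
  then have "cring (\<K>\<lparr>carrier := range ev\<rparr>)"
    using K.subcring_iff order_subset_field carrier_order by simp
  moreover have "\<O> = \<K>\<lparr>carrier := range ev\<rparr>"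
    using carrier_order by (simp add: monogenic_order_def number_field_def)
  ultimately show ?thesis by simp
qed

lemma uminus_order: "x \<in> carrier \<O> \<Longrightarrow> \<ominus>\<^bsub>\<O>\<^esub> x = - x"
proof -
  assume x: "x \<in> carrier \<O>"
  then obtain p where p: "x = ev p" by (auto simp: carrier_order)
  interpret cring \<O> by (rule cring_order)
  have "- x \<oplus>\<^bsub>\<O>\<^esub> x = \<zero>\<^bsub>\<O>\<^esub>" unfolding p by (auto simp: order_ops)
  moreover have "- x \<in> carrier \<O>" unfolding p by (simp add: carrier_order flip: ev_uminus)
  ultimately show ?thesis using minus_equality[of "- x" x] x by simp
qed

section \<open>Fractional ideals and narrow classes\<close>

lemma additive_subgroup_field_iff:
  "additive_subgroup J \<K> \<longleftrightarrow> J \<subseteq> carrier \<K> \<and> 0\<^sub>v d \<in> J \<and> (\<forall>x\<in>J. \<forall>y\<in>J. x + y \<in> J) \<and> (\<forall>x\<in>J. - x \<in> J)"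
proof -
  have "inv\<^bsub>add_monoid \<K>\<^esub> x = - x" if "x \<in> carrier \<K>" for x
    using uminus_field[OF that] by (simp add: a_inv_def)
  then show ?thesis
    by (auto simp: additive_subgroup_def subgroup_def field_ops subset_iff)
qed

lemma ideal_order_iff:
  "ideal J \<O> \<longleftrightarrow> J \<subseteq> range ev \<and> 0\<^sub>v d \<in> J \<and> (\<forall>x\<in>J. \<forall>y\<in>J. x + y \<in> J) \<and> (\<forall>x\<in>J. - x \<in> J) \<and>
     (\<forall>p. \<forall>x\<in>J. pmul (ev p) x \<in> J)"
proof -
  interpret cring \<O> by (rule cring_order)
  have inv: "inv\<^bsub>add_monoid \<O>\<^esub> x = - x" if "x \<in> carrier \<O>" for x
    using uminus_order[OF that] by (simp add: a_inv_def)
  have "ideal J \<O> \<longleftrightarrow> subgroup J (add_monoid \<O>) \<and> (\<forall>a\<in>J. \<forall>x\<in>carrier \<O>. pmul x a \<in> J)"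
    using ring_axioms
    by (auto simp: ideal_def ideal_axioms_def additive_subgroup_def mult_order pmul_commute)
  also have "\<dots> \<longleftrightarrow> J \<subseteq> range ev \<and> 0\<^sub>v d \<in> J \<and> (\<forall>x\<in>J. \<forall>y\<in>J. x + y \<in> J) \<and> (\<forall>x\<in>J. - x \<in> J) \<and>
     (\<forall>p. \<forall>x\<in>J. pmul (ev p) x \<in> J)"
    using inv by (auto simp: subgroup_def order_ops carrier_order subset_iff)
  finally show ?thesis .
qed

lemma fractional_ideal_iff:
  "fractional_ideal \<alpha> J \<longleftrightarrow> J \<subseteq> carrier \<K> \<and> 0\<^sub>v d \<in> J \<and> (\<forall>x\<in>J. \<forall>y\<in>J. x + y \<in> J) \<and> (\<forall>x\<in>J. - x \<in> J) \<and>
     (\<exists>x\<in>J. x \<noteq> 0\<^sub>v d) \<and> (\<forall>p. \<forall>x\<in>J. pmul (ev p) x \<in> J) \<and>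
     (\<exists>p. ev p \<noteq> 0\<^sub>v d \<and> (\<forall>x\<in>J. pmul (ev p) x \<in> range ev))"
  unfolding fractional_ideal_def additive_subgroup_field_iff carrier_order field_ops by blast

text \<open>Only the common denominator needs thought: if p(\<alpha>) clears those of J and \<xi> =
  q(\<alpha>)/n, then n p(\<alpha>) clears those of \<xi>J, because n p(\<alpha>) \<xi> y =
  q(\<alpha>) (p(\<alpha>) y).\<close>

lemma fractional_ideal_scale:
  assumes J: "fractional_ideal \<alpha> J" and \<xi>: "\<xi> \<in> carrier \<K>" "\<xi> \<noteq> 0\<^sub>v d"
  shows "fractional_ideal \<alpha> (pmul \<xi> ` J)"
proof -
  have JK: "J \<subseteq> carrier \<K>" and J0: "0\<^sub>v d \<in> J" and Jadd: "\<And>x y. x \<in> J \<Longrightarrow> y \<in> J \<Longrightarrow> x + y \<in> J"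
    and Jneg: "\<And>x. x \<in> J \<Longrightarrow> - x \<in> J" and Jmul: "\<And>p x. x \<in> J \<Longrightarrow> pmul (ev p) x \<in> J"
    using J by (auto simp: fractional_ideal_iff)
  have Jvec: "\<And>x. x \<in> J \<Longrightarrow> x \<in> carrier_vec d" using JK field_carrier_vec by blast
  obtain x where x: "x \<in> J" "x \<noteq> 0\<^sub>v d" using J by (auto simp: fractional_ideal_iff)
  have "x \<in> carrier \<K>" using x(1) JK by blast
  then have "pmul \<xi> x $ 0 \<noteq> 0"
    using field_inverse(2)[OF \<xi> d_pos] field_inverse(2)[OF _ x(2) d_pos] d_pos by simp
  then have nz: "pmul \<xi> x \<noteq> 0\<^sub>v d" using d_pos by (metis index_zero_vec(1))
  obtain p where p: "ev p \<noteq> 0\<^sub>v d" "\<And>x. x \<in> J \<Longrightarrow> pmul (ev p) x \<in> range ev"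
    using J by (auto simp: fractional_ideal_iff)
  obtain n q where n: "n \<noteq> 0" and q: "\<And>j. j < d \<Longrightarrow> \<xi> $ j = ev q $ j / of_int n"
    using carrier_fieldE[OF \<xi>(1)] by blast
  have "ev (smult n p) \<noteq> 0\<^sub>v d"
  proof
    assume "ev (smult n p) = 0\<^sub>v d"
    then have "ev (smult n p) $ 0 = 0" using d_pos by simp
    then have "ev p $ 0 = 0" using n d_pos by (simp add: hom_distribs)
    then show False using p(1) ev_vanishes_iff[OF d_pos] ev_eq_0_iff by simp
  qed
  moreover have "pmul (ev (smult n p)) (pmul \<xi> y) \<in> range ev" if y: "y \<in> J" for y
  proof -
    obtain r where r: "pmul (ev p) y = ev r" using p(2)[OF y] by blast
    have "pmul (ev (smult n p)) (pmul \<xi> y) = ev (q * r)"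
    proof (rule eq_vecI)
      fix j assume "j < dim_vec (ev (q * r))"
      then have j: "j < d" by simp
      have "ev p $ j * y $ j = ev r $ j" using arg_cong[OF r, of "\<lambda>v. v $ j"] j by simp
      then show "pmul (ev (smult n p)) (pmul \<xi> y) $ j = ev (q * r) $ j"
        using j n q[OF j] by (simp add: hom_distribs field_simps)
    qed simp
    then show ?thesis by simp
  qed
  ultimately show ?thesis
    unfolding fractional_ideal_iff
  proof (intro conjI allI ballI)
    show "pmul \<xi> ` J \<subseteq> carrier \<K>" using JK \<xi>(1) by (auto intro: field_closed)
    show "0\<^sub>v d \<in> pmul \<xi> ` J" using J0 pmul_0 by (metis image_eqI)
    show "\<exists>x\<in>pmul \<xi> ` J. x \<noteq> 0\<^sub>v d" using x nz by blast
    show "y + z \<in> pmul \<xi> ` J" if "y \<in> pmul \<xi> ` J" "z \<in> pmul \<xi> ` J" for y z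
      using that Jvec Jadd by (auto simp flip: pmul_add)
    show "- y \<in> pmul \<xi> ` J" if "y \<in> pmul \<xi> ` J" for y
      using that Jvec Jneg by (auto simp flip: pmul_uminus)
    show "pmul (ev q) y \<in> pmul \<xi> ` J" if "y \<in> pmul \<xi> ` J" for q y
      using that Jmul by (auto simp: pmul_left_commute[of _ \<xi>])
  qed blast
qed

section \<open>Inverses and scaled invertible ideals\<close>

definition pinv :: "complex vec \<Rightarrow> complex vec" where
  "pinv x = vec d (\<lambda>j. inverse (x $ j))"

lemma pinv_index [simp]: "j < d \<Longrightarrow> pinv x $ j = inverse (x $ j)"
  and pinv_carrier [simp]: "pinv x \<in> carrier_vec d"
  and dim_pinv [simp]: "dim_vec (pinv x) = d"
  by (auto simp: pinv_def)

lemma pinv_field: "x \<in> carrier \<K> \<Longrightarrow> x \<noteq> 0\<^sub>v d \<Longrightarrow> pinv x \<in> carrier \<K>"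
  using field_inverse(1) by (simp add: pinv_def)

lemma pinv_nonzero:
  assumes "x \<in> carrier \<K>" "x \<noteq> 0\<^sub>v d"
  shows "pinv x \<noteq> 0\<^sub>v d"
proof
  assume "pinv x = 0\<^sub>v d"
  then have "inverse (x $ 0) = 0" using d_pos by (metis pinv_index index_zero_vec(1))
  then show False using field_inverse(2)[OF assms d_pos] by simp
qed

lemma pmul_pinv:
  assumes "x \<in> carrier \<K>" "x \<noteq> 0\<^sub>v d" "y \<in> carrier_vec d"
  shows "pmul (pinv x) (pmul x y) = y" "pmul x (pmul (pinv x) y) = y"
  using assms field_inverse(2)[OF assms(1,2)] by auto

lemma pmul_nonzero:
  assumes "x \<in> carrier \<K>" "x \<noteq> 0\<^sub>v d" "y \<in> carrier \<K>" "y \<noteq> 0\<^sub>v d"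
  shows "pmul x y \<noteq> 0\<^sub>v d"
proof
  assume "pmul x y = 0\<^sub>v d"
  then have "pmul x y $ 0 = 0" using d_pos by simp
  then show False using field_inverse(2)[OF assms(1,2) d_pos] field_inverse(2)[OF assms(3,4) d_pos] d_pos
    by simp
qed

text \<open>The factors \<xi> and 1/\<xi> cancel in each product of generators. One inclusion
  suffices: the other is this one for 1/\<xi> and the scaled ideals.\<close>

lemma ideal_prod_scale_subset:
  assumes \<xi>: "\<xi> \<in> carrier \<K>" "\<xi> \<noteq> 0\<^sub>v d"
    and J: "J \<subseteq> carrier_vec d" "J' \<subseteq> carrier_vec d"
  shows "ideal_prod \<K> (pmul \<xi> ` J) (pmul (pinv \<xi>) ` J') \<subseteq> ideal_prod \<K> J J'"
proof
  fix z assume "z \<in> ideal_prod \<K> (pmul \<xi> ` J) (pmul (pinv \<xi>) ` J')"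
  then show "z \<in> ideal_prod \<K> J J'"
  proof induction
    case (prod i j)
    then obtain x y where xy: "x \<in> J" "y \<in> J'" "i = pmul \<xi> x" "j = pmul (pinv \<xi>) y" by auto
    then have "y \<in> carrier_vec d" using J by auto
    then have "i \<otimes>\<^bsub>\<K>\<^esub> j = x \<otimes>\<^bsub>\<K>\<^esub> y"
      unfolding xy mult_field pmul_assoc pmul_left_commute[of \<xi> x] using pmul_pinv[OF \<xi>] by simp
    then show ?case using xy by (simp add: ideal_prod.prod)
  qed (rule ideal_prod.sum)
qed

text \<open>If J' is inverse to J, then (1/\<xi>)J' is inverse to \<xi>J.\<close>

lemma invertible_fractional_ideal_scale:
  assumes J: "invertible_fractional_ideal \<alpha> J" and \<xi>: "\<xi> \<in> carrier \<K>" "\<xi> \<noteq> 0\<^sub>v d"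
  shows "invertible_fractional_ideal \<alpha> (pmul \<xi> ` J)"
proof -
  obtain J' where J': "fractional_ideal \<alpha> J'" and prod: "ideal_prod \<K> J J' = carrier \<O>"
    using J by (auto simp: invertible_fractional_ideal_def)
  have JK: "fractional_ideal \<alpha> J" using J by (simp add: invertible_fractional_ideal_def)
  note \<xi>' = pinv_field[OF \<xi>] pinv_nonzero[OF \<xi>]
  have vec: "J \<subseteq> carrier_vec d" "J' \<subseteq> carrier_vec d"
    using J' JK field_carrier_vec by (auto simp: fractional_ideal_iff)
  have pp: "pinv (pinv \<xi>) = \<xi>" using field_carrier_vec[OF \<xi>(1)] by auto
  have 1: "pmul (pinv \<xi>) ` pmul \<xi> ` J = J" "pmul \<xi> ` pmul (pinv \<xi>) ` J' = J'"
    using vec pmul_pinv[OF \<xi>] by (auto simp: image_image subset_iff cong: image_cong_simp)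
  have "ideal_prod \<K> (pmul \<xi> ` J) (pmul (pinv \<xi>) ` J') = ideal_prod \<K> J J'"
  proof
    show "ideal_prod \<K> (pmul \<xi> ` J) (pmul (pinv \<xi>) ` J') \<subseteq> ideal_prod \<K> J J'"
      by (rule ideal_prod_scale_subset[OF \<xi> vec])
    show "ideal_prod \<K> J J' \<subseteq> ideal_prod \<K> (pmul \<xi> ` J) (pmul (pinv \<xi>) ` J')"
      using ideal_prod_scale_subset[OF \<xi>', of "pmul \<xi> ` J" "pmul (pinv \<xi>) ` J'"] unfolding pp 1
      by fastforce
  qed
  then show ?thesis
    using fractional_ideal_scale[OF JK \<xi>] fractional_ideal_scale[OF J' \<xi>'] prod
    unfolding invertible_fractional_ideal_def by blast
qed

section \<open>Conjugation and total positivity\<close>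

lemma totally_positive_iff:
  "totally_positive \<alpha> \<xi> \<longleftrightarrow> \<xi> \<in> carrier \<K> \<and> \<xi> \<noteq> 0\<^sub>v d \<and> (\<forall>j<d. \<alpha> $ j \<in> \<real> \<longrightarrow> 0 < Re (\<xi> $ j))"
  by (simp add: totally_positive_def dim_alpha zero_field)

text \<open>Up to an integer denominator the coordinates are values of one integer polynomial at the
  roots, and such values commute with conjugation. The case \<open>i = j\<close> treats the real
  places.\<close>

lemma field_cnj:
  assumes x: "x \<in> carrier \<K>" and ij: "i < d" "j < d" "\<alpha> $ i = cnj (\<alpha> $ j)"
  shows "x $ i = cnj (x $ j)"
proof -
  have cnj_poly: "poly (map_poly of_int p) (cnj z) = cnj (poly (map_poly of_int p) z)" for p :: "int poly" and z
    by (induction p) (auto simp: map_poly_pCons)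
  show ?thesis using carrier_fieldE[OF x] ij by (metis cnj_poly complex_cnj_divide complex_cnj_of_int ev_index)
qed

lemma field_real:
  assumes "x \<in> carrier \<K>" "j < d" "\<alpha> $ j \<in> \<real>"
  shows "x $ j \<in> \<real>"
  using field_cnj[OF assms(1,2,2)] assms(3) by (simp add: Reals_cnj_iff)

lemma totally_positive_mult:
  assumes x: "totally_positive \<alpha> x" and y: "totally_positive \<alpha> y"
  shows "totally_positive \<alpha> (pmul x y)"
proof -
  have K: "x \<in> carrier \<K>" "y \<in> carrier \<K>" and nz: "x \<noteq> 0\<^sub>v d" "y \<noteq> 0\<^sub>v d"
    using x y by (auto simp: totally_positive_iff)
  \<comment> \<open>The real part of this product is the product of the real parts because both
    factors are real.\<close>
  have "0 < Re (x $ j * y $ j)" if "j < d" "\<alpha> $ j \<in> \<real>" for j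
    using field_real[OF K(1) that] field_real[OF K(2) that] x y that
    by (auto simp: totally_positive_iff complex_is_Real_iff)
  then show ?thesis
    using K nz field_closed(2)[OF K] pmul_nonzero[OF K(1) nz(1) K(2) nz(2)]
    by (auto simp: totally_positive_iff)
qed

lemma totally_positive_inverse:
  assumes x: "totally_positive \<alpha> x"
  shows "totally_positive \<alpha> (pinv x)"
proof -
  have K: "x \<in> carrier \<K>" "x \<noteq> 0\<^sub>v d" using x by (auto simp: totally_positive_iff)
  have "0 < Re (inverse (x $ j))" if "j < d" "\<alpha> $ j \<in> \<real>" for j
    using field_real[OF K(1) that] x that
    by (auto simp: totally_positive_iff complex_is_Real_iff power2_eq_square)
  then show ?thesis
    using pinv_field[OF K] pinv_nonzero[OF K] by (auto simp: totally_positive_iff)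
qed

section \<open>The narrow equivalence relation\<close>

lemma narrow_rel_iff:
  "(J, J') \<in> narrow_rel \<alpha> \<longleftrightarrow> invertible_fractional_ideal \<alpha> J \<and> invertible_fractional_ideal \<alpha> J' \<and>
     (\<exists>\<xi>. totally_positive \<alpha> \<xi> \<and> J' = pmul \<xi> ` J)"
  by (simp add: narrow_rel_def mult_field[abs_def])

lemma invertible_fractional_ideal_vec:
  "invertible_fractional_ideal \<alpha> J \<Longrightarrow> x \<in> J \<Longrightarrow> x \<in> carrier_vec d"
  using field_carrier_vec by (auto simp: invertible_fractional_ideal_def fractional_ideal_iff)

text \<open>The totally positive elements form a group; its unit, inverses and products give
  reflexivity, symmetry and transitivity.\<close>

lemma equiv_narrow_rel: "equiv {J. invertible_fractional_ideal \<alpha> J} (narrow_rel \<alpha>)"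
proof (rule equivI)
  show "narrow_rel \<alpha> \<subseteq> {J. invertible_fractional_ideal \<alpha> J} \<times> {J. invertible_fractional_ideal \<alpha> J}"
    by (auto simp: narrow_rel_iff)
  show "refl_on {J. invertible_fractional_ideal \<alpha> J} (narrow_rel \<alpha>)"
  proof (rule refl_onI)
    fix J assume "J \<in> {J. invertible_fractional_ideal \<alpha> J}"
    then have J: "invertible_fractional_ideal \<alpha> J" by simp
    let ?one = "vec d (\<lambda>j. 1) :: complex vec"
    have "?one \<noteq> 0\<^sub>v d" using d_pos by (metis index_vec index_zero_vec(1) zero_neq_one)
    then have "totally_positive \<alpha> ?one" using one_in_field by (simp add: totally_positive_iff)
    moreover have "pmul ?one x = x" if "x \<in> J" for x
      using invertible_fractional_ideal_vec[OF J that] by auto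
    then have "J = pmul ?one ` J" by (simp cong: image_cong_simp)
    ultimately show "(J, J) \<in> narrow_rel \<alpha>" using J by (auto simp: narrow_rel_iff)
  qed
  show "sym (narrow_rel \<alpha>)"
  proof (rule symI)
    fix J J' assume "(J, J') \<in> narrow_rel \<alpha>"
    then obtain \<xi> where *: "invertible_fractional_ideal \<alpha> J" "invertible_fractional_ideal \<alpha> J'"
      and \<xi>: "totally_positive \<alpha> \<xi>" "J' = pmul \<xi> ` J" by (auto simp: narrow_rel_iff)
    have "pmul (pinv \<xi>) (pmul \<xi> x) = x" if "x \<in> J" for x
      using invertible_fractional_ideal_vec[OF *(1) that] \<xi>(1) pmul_pinv by (simp add: totally_positive_iff)
    then have "J = pmul (pinv \<xi>) ` J'" unfolding \<xi>(2) by (simp add: image_image cong: image_cong_simp)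
    then show "(J', J) \<in> narrow_rel \<alpha>"
      using * totally_positive_inverse[OF \<xi>(1)] by (auto simp: narrow_rel_iff)
  qed
  show "trans (narrow_rel \<alpha>)"
  proof (rule transI)
    fix J J' J'' assume "(J, J') \<in> narrow_rel \<alpha>" "(J', J'') \<in> narrow_rel \<alpha>"
    then obtain \<xi> \<eta> where *: "invertible_fractional_ideal \<alpha> J" "invertible_fractional_ideal \<alpha> J''"
      and \<xi>: "totally_positive \<alpha> \<xi>" "J' = pmul \<xi> ` J" "totally_positive \<alpha> \<eta>" "J'' = pmul \<eta> ` J'"
      by (auto simp: narrow_rel_iff)
    have "J'' = pmul (pmul \<eta> \<xi>) ` J" by (simp add: \<xi> image_image pmul_assoc)
    then show "(J, J'') \<in> narrow_rel \<alpha>"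
      using * totally_positive_mult[OF \<xi>(3,1)] by (auto simp: narrow_rel_iff)
  qed
qed

end

section \<open>Integer matrices and double cosets\<close>

abbreviation cdiag :: "nat \<Rightarrow> complex vec \<Rightarrow> complex mat" where
  "cdiag d \<xi> \<equiv> mat_diag d (\<lambda>j. \<xi> $ j)"

lemma square_mult_carrier: "A \<in> carrier_mat d d \<Longrightarrow> B \<in> carrier_mat d d \<Longrightarrow> A * B \<in> carrier_mat d d"
  by simp

lemma one_SL: "1\<^sub>m d \<in> SL d"
  by (simp add: SL_def)

lemma SL_mult: "A \<in> SL d \<Longrightarrow> B \<in> SL d \<Longrightarrow> A * B \<in> SL d"
  by (auto simp: SL_def det_mult)

lemma SL_carrier: "A \<in> SL d \<Longrightarrow> A \<in> carrier_mat d d"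
  by (simp add: SL_def)

lemma SL_inverse:
  assumes "A \<in> SL d"
  obtains A' where "A' \<in> SL d" "A * A' = 1\<^sub>m d" "A' * A = 1\<^sub>m d"
proof -
  have A: "A \<in> carrier_mat d d" "det A = 1" using assms by (auto simp: SL_def)
  have eq: "A * adj_mat A = 1\<^sub>m d" "adj_mat A * A = 1\<^sub>m d"
    using adj_mat(2,3)[OF A(1)] A(2) by auto
  have "det A * det (adj_mat A) = 1"
    using arg_cong[OF eq(1), of det] det_mult[OF A(1) adj_mat(1)[OF A(1)]] by simp
  then have "adj_mat A \<in> SL d" using A adj_mat(1)[OF A(1)] by (simp add: SL_def)
  then show thesis using eq that by blast
qed

lemma cmat_mult: "A \<in> carrier_mat d d \<Longrightarrow> B \<in> carrier_mat d d \<Longrightarrow> cmat (A * B) = cmat A * cmat B"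
  by (rule of_int_hom.mat_hom_mult)

lemma cmat_one: "cmat (1\<^sub>m d) = 1\<^sub>m d"
  by (rule eq_matI) auto

lemma det_mat_diag: "det (mat_diag d f) = (\<Prod>j<d. f j)"
proof -
  have "det (mat_diag d f) = prod_list (diag_mat (mat_diag d f))"
    by (rule det_upper_triangular[of _ d]) (auto simp: mat_diag_def)
  also have "\<dots> = (\<Prod>j<d. f j)"
    unfolding prod_list_diag_prod by (rule prod.cong) (auto simp: mat_diag_def)
  finally show ?thesis .
qed

lemma complex_mat_inverse:
  fixes B :: "complex mat"
  assumes B: "B \<in> carrier_mat d d" "det B \<noteq> 0"
  obtains B' where "B' \<in> carrier_mat d d" "B * B' = 1\<^sub>m d" "B' * B = 1\<^sub>m d"
proof -
  from det_non_zero_imp_unit[OF B, of "()"] have "B \<in> Units (ring_mat TYPE(complex) d ())" .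
  then show thesis using that by (auto simp: Units_def ring_mat_def)
qed

subsection \<open>The unipotent group\<close>

text \<open>These are the elements of U with their free column as a parameter. The entries are
  polymorphic because the same matrices act on complex matrices in
  \<open>root_mat_unique\<close>.\<close>

definition shear :: "nat \<Rightarrow> (nat \<Rightarrow> 'a :: comm_ring_1) \<Rightarrow> 'a mat" where
  "shear d t = mat d d (\<lambda>(i, j). if j = d - 1 \<and> i < d - 1 then t i else if i = j then 1 else 0)"

lemma shear_carrier [simp]: "shear d t \<in> carrier_mat d d"
  by (simp add: shear_def)

lemma cmat_shear: "cmat (shear d t) = shear d (\<lambda>i. of_int (t i))"
  by (rule eq_matI) (auto simp: shear_def)

lemma U_group_eq: "U_group d = range (shear d)"
proof (intro equalityI subsetI)
  fix A assume A: "A \<in> U_group d"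
  then have "A = shear d (\<lambda>i. A $$ (i, d - 1))"
    by (intro eq_matI) (auto simp: U_group_def SL_def shear_def)
  then show "A \<in> range (shear d)" by blast
next
  fix A :: "int mat" assume "A \<in> range (shear d)"
  then obtain t where A: "A = shear d t" by blast
  have "det (shear d t) = prod_list (diag_mat (shear d t))"
    by (rule det_upper_triangular[of _ d]) (auto simp: shear_def upper_triangular_def)
  also have "\<dots> = 1"
    unfolding prod_list_diag_prod by (rule prod.neutral) (auto simp: shear_def)
  finally show "A \<in> U_group d"
    by (auto simp: A U_group_def SL_def shear_def)
qed

lemma shear_mult:
  assumes "A \<in> carrier_mat d d"
  shows "shear d t * A = mat d d (\<lambda>(i, j). A $$ (i, j) + (if i < d - 1 then t i * A $$ (d - 1, j) else 0))"
proof (rule eq_matI)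
  fix i j assume "i < dim_row (mat d d (\<lambda>(i, j). A $$ (i, j) + (if i < d - 1 then t i * A $$ (d - 1, j) else 0)))"
    "j < dim_col (mat d d (\<lambda>(i, j). A $$ (i, j) + (if i < d - 1 then t i * A $$ (d - 1, j) else 0)))"
  then have ij: "i < d" "j < d" by auto
  have "(shear d t * A) $$ (i, j) = (\<Sum>k<d. shear d t $$ (i, k) * A $$ (k, j))"
    using ij assms by (auto simp: scalar_prod_def shear_def lessThan_atLeast0 intro!: sum.cong)
  also have "\<dots> = (\<Sum>k<d. (if k = i then A $$ (k, j) else 0) +
      (if k = d - 1 then (if i < d - 1 then t i * A $$ (k, j) else 0) else 0))"
    using ij by (intro sum.cong) (auto simp: shear_def)
  also have "\<dots> = A $$ (i, j) + (if i < d - 1 then t i * A $$ (d - 1, j) else 0)"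
    using ij by (simp add: sum.distrib)
  finally show "(shear d t * A) $$ (i, j) =
      mat d d (\<lambda>(i, j). A $$ (i, j) + (if i < d - 1 then t i * A $$ (d - 1, j) else 0)) $$ (i, j)"
    using ij by simp
qed (use assms in \<open>auto simp: shear_def\<close>)

text \<open>A row operation adds multiples of the last row, which for a shear is the last unit
  vector. So U is additive, which supplies its products and inverses.\<close>

lemma shear_add: "shear d s * shear d t = shear d (\<lambda>i. s i + t i)"
  unfolding shear_mult[OF shear_carrier] by (rule eq_matI) (auto simp: shear_def)

lemma shear_0: "shear d (\<lambda>_. 0) = 1\<^sub>m d"
  by (rule eq_matI) (auto simp: shear_def)

lemma U_group_SL: "u \<in> U_group d \<Longrightarrow> u \<in> SL d"
  by (simp add: U_group_def)

lemma one_U_group: "1\<^sub>m d \<in> U_group d"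
  unfolding U_group_eq by (metis rangeI shear_0)

lemma U_group_mult: "u \<in> U_group d \<Longrightarrow> v \<in> U_group d \<Longrightarrow> u * v \<in> U_group d"
  unfolding U_group_eq by (auto simp: shear_add)

lemma U_group_inverse:
  assumes "u \<in> U_group d"
  obtains v where "v \<in> U_group d" "u * v = 1\<^sub>m d" "v * u = 1\<^sub>m d"
proof -
  obtain t where u: "u = shear d t" using assms U_group_eq by blast
  show thesis
    by (rule that[of "shear d (\<lambda>i. - t i)"]) (auto simp: u shear_add shear_0 U_group_eq)
qed

subsection \<open>Positive vectors and the unit groups\<close>

lemma C_plus_carrier: "\<xi> \<in> C_plus r1 r2 \<Longrightarrow> \<xi> \<in> carrier_vec (r1 + 2 * r2)"
  by (simp add: C_plus_def C_space_def)

lemma C_plus_one: "vec (r1 + 2 * r2) (\<lambda>j. 1) \<in> C_plus r1 r2"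
  by (auto simp: C_plus_def C_space_def)

lemma C_plus_mult:
  assumes "\<xi> \<in> C_plus r1 r2" "\<eta> \<in> C_plus r1 r2"
  shows "vec (r1 + 2 * r2) (\<lambda>j. \<xi> $ j * \<eta> $ j) \<in> C_plus r1 r2"
  using assms by (auto simp: C_plus_def C_space_def complex_is_Real_iff)

lemma C_plus_inverse:
  assumes "\<xi> \<in> C_plus r1 r2"
  shows "vec (r1 + 2 * r2) (\<lambda>j. inverse (\<xi> $ j)) \<in> C_plus r1 r2"
  using assms by (auto simp: C_plus_def C_space_def complex_is_Real_iff power2_eq_square)

text \<open>Real coordinates are positive, and each conjugate pair contributes a squared absolute
  value. Only \<open>t \<ge> 0\<close> can be claimed, since \<open>C_plus\<close> admits zeros at
  complex places.\<close>

lemma prod_C_plus: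
  assumes "\<xi> \<in> C_plus r1 r2"
  obtains t where "t \<ge> 0" "(\<Prod>j<r1 + 2 * r2. \<xi> $ j) = complex_of_real t"
proof -
  have real: "\<xi> $ j = complex_of_real (Re (\<xi> $ j))" "0 < Re (\<xi> $ j)" if "j < r1" for j
    using assms that by (auto simp: C_plus_def C_space_def complex_is_Real_iff complex_eq_iff)
  have cnj: "\<xi> $ (r1 + 2 * k + 1) = cnj (\<xi> $ (r1 + 2 * k))" if "k < r2" for k
    using assms that by (auto simp: C_plus_def C_space_def)
  have prefix: "(\<Prod>j<r1 + 2 * k. \<xi> $ j) =
      complex_of_real ((\<Prod>j<r1. Re (\<xi> $ j)) * (\<Prod>i<k. (cmod (\<xi> $ (r1 + 2 * i)))\<^sup>2))" if "k \<le> r2" for k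
    using that
  proof (induction k)
    case 0
    have "(\<Prod>j<r1. \<xi> $ j) = (\<Prod>j<r1. complex_of_real (Re (\<xi> $ j)))"
      using real(1) by (intro prod.cong) auto
    then show ?case by simp
  next
    case (Suc k)
    have "(\<Prod>j<r1 + 2 * Suc k. \<xi> $ j) =
        (\<Prod>j<r1 + 2 * k. \<xi> $ j) * (\<xi> $ (r1 + 2 * k) * \<xi> $ (r1 + 2 * k + 1))"
      by (simp add: mult.assoc)
    also have "\<xi> $ (r1 + 2 * k) * \<xi> $ (r1 + 2 * k + 1) = complex_of_real ((cmod (\<xi> $ (r1 + 2 * k)))\<^sup>2)"
      unfolding cnj[of k, OF Suc_le_lessD[OF Suc.prems]] by (simp only: complex_norm_square)
    finally show ?case using Suc by (simp add: mult.assoc)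
  qed
  show thesis
    by (intro that[OF _ prefix[OF order_refl]] mult_nonneg_nonneg prod_nonneg)
      (auto intro: less_imp_le real(2))
qed

lemma cdiag_mult:
  assumes "d = r1 + 2 * r2" "\<xi> \<in> C_plus r1 r2" "\<eta> \<in> C_plus r1 r2"
  shows "cdiag d \<xi> * cdiag d \<eta> = cdiag d (vec (r1 + 2 * r2) (\<lambda>j. \<xi> $ j * \<eta> $ j))"
  unfolding mat_diag_diag using assms by (auto simp: mat_diag_def)

lemma cdiag_inverse:
  assumes "\<And>j. j < d \<Longrightarrow> \<xi> $ j \<noteq> 0"
  shows "cdiag d \<xi> * cdiag d (vec d (\<lambda>j. inverse (\<xi> $ j))) = 1\<^sub>m d"
    "cdiag d (vec d (\<lambda>j. inverse (\<xi> $ j))) * cdiag d \<xi> = 1\<^sub>m d"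
  unfolding mat_diag_diag using assms by (auto simp: mat_diag_def)

lemma det_mult_cdiag_nonzero:
  assumes "A \<in> carrier_mat d d" "det (A * cdiag d \<xi>) \<noteq> 0" "j < d"
  shows "\<xi> $ j \<noteq> 0"
  using assms by (auto simp: det_mult[of _ d] det_mat_diag)

text \<open>Multiplying by B on the right removes the inverse matrix from the definition; all later
  arguments about the group use this form.\<close>

lemma unit_group_iff:
  assumes d: "d = r1 + 2 * r2" and B: "B \<in> carrier_mat d d" "det B \<noteq> 0"
  shows "A \<in> unit_group r1 r2 B \<longleftrightarrow> A \<in> SL d \<and> (\<exists>\<xi>\<in>C_plus r1 r2. cmat A * B = B * cdiag d \<xi>)"
proof
  assume "A \<in> unit_group r1 r2 B"
  then obtain \<xi> Binv where A: "A \<in> SL d" and \<xi>: "\<xi> \<in> C_plus r1 r2" and Binv: "Binv \<in> carrier_mat d d"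
    and inv: "inverts_mat Binv B" and eq: "cmat A = B * cdiag d \<xi> * Binv"
    by (auto simp: unit_group_def d Let_def)
  have "cmat A * B = B * cdiag d \<xi> * (Binv * B)"
    unfolding eq using B Binv by (simp add: assoc_mult_mat[of _ d d _ d _ d] square_mult_carrier[of _ d])
  also have "\<dots> = B * cdiag d \<xi>"
    using inv Binv B by (simp add: inverts_mat_def right_mult_one_mat[of _ d d])
  finally show "A \<in> SL d \<and> (\<exists>\<xi>\<in>C_plus r1 r2. cmat A * B = B * cdiag d \<xi>)" using A \<xi> by blast
next
  assume "A \<in> SL d \<and> (\<exists>\<xi>\<in>C_plus r1 r2. cmat A * B = B * cdiag d \<xi>)"
  then obtain \<xi> where A: "A \<in> SL d" and \<xi>: "\<xi> \<in> C_plus r1 r2" and eq: "cmat A * B = B * cdiag d \<xi>" by auto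
  obtain Binv where Binv: "Binv \<in> carrier_mat d d" "B * Binv = 1\<^sub>m d" "Binv * B = 1\<^sub>m d"
    using complex_mat_inverse[OF B] by blast
  have "cmat A = cmat A * (B * Binv)"
    using SL_carrier[OF A] Binv by (simp add: right_mult_one_mat[of _ d d])
  also have "\<dots> = cmat A * B * Binv"
    using SL_carrier[OF A] B Binv by (simp add: assoc_mult_mat[of _ d d _ d _ d] del: Binv(2))
  also have "\<dots> = B * cdiag d \<xi> * Binv" unfolding eq ..
  finally show "A \<in> unit_group r1 r2 B"
    using A \<xi> Binv B by (auto simp: unit_group_def d Let_def inverts_mat_def)
qed

text \<open>Solving the identity gives \<gamma>^(-1) \<gamma>' B = B diag(\<xi>/\<xi>'), and
  \<open>C_plus\<close> is closed under this quotient. Zeros of \<xi>' have to be excluded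
  separately, as they may occur at complex places.\<close>

lemma unit_group_coset:
  assumes d: "d = r1 + 2 * r2" and B: "B \<in> carrier_mat d d" "det B \<noteq> 0"
    and \<gamma>: "\<gamma> \<in> SL d" "\<gamma>' \<in> SL d" and \<xi>: "\<xi> \<in> C_plus r1 r2" "\<xi>' \<in> C_plus r1 r2"
    and nz: "\<And>j. j < d \<Longrightarrow> \<xi>' $ j \<noteq> 0"
    and eq: "cmat \<gamma> * B * cdiag d \<xi> = cmat \<gamma>' * B * cdiag d \<xi>'"
  shows "\<exists>g\<in>unit_group r1 r2 B. \<gamma>' = \<gamma> * g"
proof -
  note assoc = assoc_mult_mat[of _ d d _ d _ d]
  obtain \<delta> where \<delta>: "\<delta> \<in> SL d" "\<gamma> * \<delta> = 1\<^sub>m d" "\<delta> * \<gamma> = 1\<^sub>m d" using SL_inverse[OF \<gamma>(1)] by blast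
  note car = \<gamma>[THEN SL_carrier] \<delta>(1)[THEN SL_carrier]
  let ?\<eta> = "vec (r1 + 2 * r2) (\<lambda>j. inverse (\<xi>' $ j))"
  let ?\<zeta> = "vec (r1 + 2 * r2) (\<lambda>j. \<xi> $ j * ?\<eta> $ j)"
  have \<eta>: "?\<eta> \<in> C_plus r1 r2" by (rule C_plus_inverse[OF \<xi>(2)])
  have inv: "cdiag d \<xi>' * cdiag d ?\<eta> = 1\<^sub>m d" using cdiag_inverse[OF nz] d by simp
  have prod: "cdiag d \<xi> * cdiag d ?\<eta> = cdiag d ?\<zeta>" by (rule cdiag_mult[OF d \<xi>(1) \<eta>])
  have "cmat (\<delta> * \<gamma>') * B = cmat \<delta> * (cmat \<gamma>' * B)"
    using car B by (simp add: cmat_mult[of _ d] assoc)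
  also have "cmat \<gamma>' * B = cmat \<gamma>' * B * (cdiag d \<xi>' * cdiag d ?\<eta>)"
    unfolding inv using car B by (simp add: right_mult_one_mat[of _ d d])
  also have "\<dots> = (cmat \<gamma>' * B * cdiag d \<xi>') * cdiag d ?\<eta>"
    using car B by (simp add: assoc square_mult_carrier[of _ d] del: mat_diag_diag)
  also have "\<dots> = cmat \<gamma> * (B * (cdiag d \<xi> * cdiag d ?\<eta>))"
    unfolding eq[symmetric] using car B by (simp add: assoc square_mult_carrier[of _ d] del: mat_diag_diag)
  also have "cmat \<delta> * (cmat \<gamma> * (B * (cdiag d \<xi> * cdiag d ?\<eta>))) = cmat (\<delta> * \<gamma>) * (B * cdiag d ?\<zeta>)"
    unfolding prod using car B by (simp add: assoc cmat_mult[of _ d])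
  also have "\<dots> = B * cdiag d ?\<zeta>" using \<delta> B by (simp add: cmat_one)
  finally have "\<delta> * \<gamma>' \<in> unit_group r1 r2 B"
    unfolding unit_group_iff[OF d B] using SL_mult[OF \<delta>(1) \<gamma>(2)] C_plus_mult[OF \<xi>(1) \<eta>] by blast
  moreover have "\<gamma>' = \<gamma> * (\<delta> * \<gamma>')"
    using car \<delta>(2) by (simp add: assoc[symmetric])
  ultimately show ?thesis by blast
qed

text \<open>A has determinant 1, so the determinant of B diag(\<xi>) is that of B and no diagonal
  entry can vanish.\<close>

lemma unit_group_nonzero:
  assumes "B \<in> carrier_mat d d" "det B \<noteq> 0" "A \<in> SL d" "cmat A * B = B * cdiag d \<xi>" "j < d"
  shows "\<xi> $ j \<noteq> 0"
proof (rule det_mult_cdiag_nonzero[OF assms(1) _ assms(5)])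
  have "det (cmat A) = 1" using assms(3) by (simp add: SL_def)
  then show "det (B * cdiag d \<xi>) \<noteq> 0"
    using assms(1-3) by (simp add: assms(4)[symmetric] det_mult[of _ d] SL_def)
qed

lemma one_unit_group:
  assumes "d = r1 + 2 * r2" "B \<in> carrier_mat d d" "det B \<noteq> 0"
  shows "1\<^sub>m d \<in> unit_group r1 r2 B"
proof -
  have "cdiag d (vec (r1 + 2 * r2) (\<lambda>j. 1)) = 1\<^sub>m d" using assms(1) by (auto simp: mat_diag_def)
  then have "cmat (1\<^sub>m d) * B = B * cdiag d (vec (r1 + 2 * r2) (\<lambda>j. 1))"
    using assms(2) by (simp add: cmat_one)
  then show ?thesis
    unfolding unit_group_iff[OF assms] using one_SL C_plus_one by blast
qed

lemma unit_group_mult: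
  assumes d: "d = r1 + 2 * r2" and B: "B \<in> carrier_mat d d" "det B \<noteq> 0"
    and g: "g \<in> unit_group r1 r2 B" "h \<in> unit_group r1 r2 B"
  shows "g * h \<in> unit_group r1 r2 B"
proof -
  note assoc = assoc_mult_mat[of _ d d _ d _ d]
  obtain \<xi> where g': "g \<in> SL d" "\<xi> \<in> C_plus r1 r2" "cmat g * B = B * cdiag d \<xi>"
    using g(1) unit_group_iff[OF d B] by auto
  obtain \<eta> where h': "h \<in> SL d" "\<eta> \<in> C_plus r1 r2" "cmat h * B = B * cdiag d \<eta>"
    using g(2) unit_group_iff[OF d B] by auto
  note car = g'(1)[THEN SL_carrier] h'(1)[THEN SL_carrier]
  have "cmat (g * h) * B = cmat g * (cmat h * B)" using car B by (simp add: cmat_mult[of _ d] assoc)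
  also have "\<dots> = (cmat g * B) * cdiag d \<eta>" unfolding h'(3) using car B by (simp add: assoc)
  also have "\<dots> = B * (cdiag d \<xi> * cdiag d \<eta>)" unfolding g'(3) using B by (simp add: assoc square_mult_carrier[of _ d] del: mat_diag_diag)
  also have "\<dots> = B * cdiag d (vec (r1 + 2 * r2) (\<lambda>j. \<xi> $ j * \<eta> $ j))"
    unfolding cdiag_mult[OF d g'(2) h'(2)] ..
  finally show ?thesis
    unfolding unit_group_iff[OF d B] using SL_mult[OF g'(1) h'(1)] C_plus_mult[OF g'(2) h'(2)] by blast
qed

lemma unit_group_SL: "g \<in> unit_group r1 r2 B \<Longrightarrow> g \<in> SL (r1 + 2 * r2)"
  by (simp add: unit_group_def Let_def)

lemma unit_group_inverse:
  assumes d: "d = r1 + 2 * r2" and B: "B \<in> carrier_mat d d" "det B \<noteq> 0"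
    and g: "g \<in> unit_group r1 r2 B"
  obtains h where "h \<in> unit_group r1 r2 B" "g * h = 1\<^sub>m d" "h * g = 1\<^sub>m d"
proof -
  obtain \<xi> where g': "g \<in> SL d" "\<xi> \<in> C_plus r1 r2" "cmat g * B = B * cdiag d \<xi>"
    using g unit_group_iff[OF d B] by auto
  let ?one = "vec (r1 + 2 * r2) (\<lambda>j. 1) :: complex vec"
  have one: "cdiag d ?one = 1\<^sub>m d" using d by (auto simp: mat_diag_def)
  \<comment> \<open>Read this way, the defining identity of \<open>g\<close> compares
    \<open>g\<close> with the identity matrix, so the coset lemma produces a right inverse inside
    the group. It agrees with the inverse in SL.\<close>
  have "cmat g * B * cdiag d ?one = cmat (1\<^sub>m d) * B * cdiag d \<xi>"
    using g' B unfolding one by (simp add: cmat_one right_mult_one_mat[of _ d d])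
  from unit_group_coset[OF d B g'(1) one_SL C_plus_one g'(2) unit_group_nonzero[OF B g'(1,3)] this]
  obtain h where h: "h \<in> unit_group r1 r2 B" "1\<^sub>m d = g * h" by blast
  obtain k where k: "k \<in> SL d" "g * k = 1\<^sub>m d" "k * g = 1\<^sub>m d" using SL_inverse[OF g'(1)] by blast
  have "h \<in> carrier_mat d d" using unit_group_SL[OF h(1)] d by (simp add: SL_carrier)
  then have "h = k * g * h" using k(3) by simp
  also have "\<dots> = k * (g * h)" using k(1) g'(1) \<open>h \<in> carrier_mat d d\<close> by (simp add: assoc_mult_mat[of _ d d _ d _ d] SL_def)
  also have "\<dots> = k" using SL_carrier[OF k(1)] unfolding h(2)[symmetric] by (rule right_mult_one_mat)
  finally have "h = k" .
  with h k that show thesis by blast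
qed

text \<open>Both groups have products and inverses, so the factors relating \<gamma> to the original
  representative can be moved into the outer factors. Hence a coset can always be described from the
  element at hand.\<close>

lemma double_cosets_eq:
  assumes d: "d = r1 + 2 * r2" and B: "B \<in> carrier_mat d d" "det B \<noteq> 0"
    and D: "D \<in> double_cosets r1 r2 B" and \<gamma>: "\<gamma> \<in> D"
  shows "\<gamma> \<in> SL d" and "D = {u * \<gamma> * g | u g. u \<in> U_group d \<and> g \<in> unit_group r1 r2 B}"
proof -
  note assoc = assoc_mult_mat[of _ d d _ d _ d]
  obtain \<delta> where \<delta>: "\<delta> \<in> SL d" and D_eq: "D = {u * \<delta> * g | u g. u \<in> U_group d \<and> g \<in> unit_group r1 r2 B}"
    using D unfolding double_cosets_def d by blast
  obtain u g where u: "u \<in> U_group d" and g: "g \<in> unit_group r1 r2 B" and eq: "\<gamma> = u * \<delta> * g"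
    using \<gamma> D_eq by blast
  have gSL: "x \<in> SL d" if "x \<in> unit_group r1 r2 B" for x using unit_group_SL[OF that] d by simp
  show "\<gamma> \<in> SL d" unfolding eq by (intro SL_mult U_group_SL[OF u] \<delta> gSL[OF g])
  obtain u' where u': "u' \<in> U_group d" "u * u' = 1\<^sub>m d" "u' * u = 1\<^sub>m d" using U_group_inverse[OF u] by blast
  obtain g' where g': "g' \<in> unit_group r1 r2 B" "g * g' = 1\<^sub>m d" "g' * g = 1\<^sub>m d"
    using unit_group_inverse[OF d B g] by blast
  have car: "u \<in> carrier_mat d d" "u' \<in> carrier_mat d d" "g \<in> carrier_mat d d" "g' \<in> carrier_mat d d"
    "\<delta> \<in> carrier_mat d d" using u u' g g' gSL \<delta> by (simp_all add: U_group_def SL_def)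
  show "D = {u * \<gamma> * g | u g. u \<in> U_group d \<and> g \<in> unit_group r1 r2 B}"
  proof (intro equalityI subsetI)
    fix x assume "x \<in> D"
    then obtain v h where v: "v \<in> U_group d" and h: "h \<in> unit_group r1 r2 B" and x: "x = v * \<delta> * h"
      using D_eq by blast
    have vh: "v \<in> carrier_mat d d" "h \<in> carrier_mat d d"
      using v h gSL by (simp_all add: U_group_def SL_def)
    have "(v * u') * \<gamma> * (g' * h) = v * ((u' * u) * \<delta> * (g * g')) * h"
      unfolding eq using car vh by (simp add: assoc)
    also have "\<dots> = x" unfolding x u' g' using car vh by (simp add: assoc)
    finally show "x \<in> {u * \<gamma> * g | u g. u \<in> U_group d \<and> g \<in> unit_group r1 r2 B}"
      using U_group_mult[OF v u'(1)] unit_group_mult[OF d B g'(1) h] by blast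
  next
    fix x assume "x \<in> {u * \<gamma> * g | u g. u \<in> U_group d \<and> g \<in> unit_group r1 r2 B}"
    then obtain v h where v: "v \<in> U_group d" and h: "h \<in> unit_group r1 r2 B" and x: "x = v * \<gamma> * h" by blast
    have vh: "v \<in> carrier_mat d d" "h \<in> carrier_mat d d"
      using v h gSL by (simp_all add: U_group_def SL_def)
    have "x = (v * u) * \<delta> * (g * h)" unfolding x eq using car vh by (simp add: assoc)
    then show "x \<in> D"
      unfolding D_eq using U_group_mult[OF v u] unit_group_mult[OF d B g h] by blast
  qed
qed

subsection \<open>Lattices and transition matrices\<close>

lemma embedding_mat_carrier [simp]: "embedding_mat d b \<in> carrier_mat d d"
  by (simp add: embedding_mat_def)

lemma int_comb_carrier [simp]: "int_comb d b c \<in> carrier_vec d"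
  by (simp add: int_comb_def)

lemma embedding_mat_int_comb:
  assumes "M \<in> carrier_mat d d"
  shows "embedding_mat d (\<lambda>i. int_comb d b (\<lambda>k. M $$ (i, k))) = cmat M * embedding_mat d b"
  by (rule eq_matI) (use assms in \<open>auto simp: embedding_mat_def int_comb_def scalar_prod_def
      lessThan_atLeast0 intro!: sum.cong\<close>)

lemma int_span_subset:
  assumes M: "M \<in> carrier_mat d d" and eq: "embedding_mat d b' = cmat M * embedding_mat d b"
  shows "int_span d b' \<subseteq> int_span d b"
proof
  fix x assume "x \<in> int_span d b'"
  then obtain c where x: "x = int_comb d b' c" by (auto simp: int_span_def)
  have b': "b' i $ j = (\<Sum>k<d. of_int (M $$ (i, k)) * b k $ j)" if "i < d" "j < d" for i j
    using arg_cong[OF eq, of "\<lambda>A. A $$ (i, j)"] that M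
    by (simp add: embedding_mat_def scalar_prod_def lessThan_atLeast0)
  have "x = int_comb d b (\<lambda>k. \<Sum>i<d. c i * M $$ (i, k))"
  proof (rule eq_vecI)
    fix j assume "j < dim_vec (int_comb d b (\<lambda>k. \<Sum>i<d. c i * M $$ (i, k)))"
    then have j: "j < d" by (simp add: int_comb_def)
    have "x $ j = (\<Sum>i<d. \<Sum>k<d. of_int (c i) * of_int (M $$ (i, k)) * b k $ j)"
      using j by (simp add: x int_comb_def b' sum_distrib_left mult.assoc)
    also have "\<dots> = (\<Sum>k<d. \<Sum>i<d. of_int (c i) * of_int (M $$ (i, k)) * b k $ j)"
      by (rule sum.swap)
    also have "\<dots> = int_comb d b (\<lambda>k. \<Sum>i<d. c i * M $$ (i, k)) $ j"
      using j by (simp add: int_comb_def sum_distrib_right)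
    finally show "x $ j = int_comb d b (\<lambda>k. \<Sum>i<d. c i * M $$ (i, k)) $ j" .
  qed (simp add: x int_comb_def)
  then show "x \<in> int_span d b" by (auto simp: int_span_def)
qed

text \<open>The inverse of the transition matrix is integral as well, so the inclusion of spans
  applies in both directions.\<close>

lemma int_span_SL:
  assumes A: "A \<in> SL d" and eq: "embedding_mat d b' = cmat A * embedding_mat d b"
  shows "int_span d b' = int_span d b"
proof
  note car = SL_carrier[OF A]
  show "int_span d b' \<subseteq> int_span d b" by (rule int_span_subset[OF car eq])
  obtain A' where A': "A' \<in> SL d" "A' * A = 1\<^sub>m d" using SL_inverse[OF A] by blast
  note car' = SL_carrier[OF A'(1)]
  have "cmat A' * embedding_mat d b' = cmat (A' * A) * embedding_mat d b"
    unfolding eq using car car' by (simp add: cmat_mult[of _ d] assoc_mult_mat[of _ d d _ d _ d])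
  then have "embedding_mat d b = cmat A' * embedding_mat d b'" 
    by (simp add: A' cmat_one left_mult_one_mat[OF embedding_mat_carrier])
  then show "int_span d b \<subseteq> int_span d b'" by (rule int_span_subset[OF car'])
qed

lemma int_span_transition:
  assumes "\<And>i. i < d \<Longrightarrow> b' i \<in> int_span d b"
  obtains M where "M \<in> carrier_mat d d" "embedding_mat d b' = cmat M * embedding_mat d b"
proof -
  from assms have "\<forall>i. \<exists>c. i < d \<longrightarrow> b' i = int_comb d b c" by (auto simp: int_span_def)
  then obtain c where c: "\<And>i. i < d \<Longrightarrow> b' i = int_comb d b (c i)" by metis
  let ?M = "mat d d (\<lambda>(i, k). c i k)"
  have "embedding_mat d b' = embedding_mat d (\<lambda>i. int_comb d b (\<lambda>k. ?M $$ (i, k)))"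
    by (rule eq_matI) (auto simp: embedding_mat_def c int_comb_def)
  then show thesis using that[of ?M] embedding_mat_int_comb[of ?M d b] by simp
qed

lemma int_span_basis_mem: "i < d \<Longrightarrow> b i \<in> carrier_vec d \<Longrightarrow> b i \<in> int_span d b"
proof -
  assume i: "i < d" "b i \<in> carrier_vec d"
  have "b i $ j = (\<Sum>k<d. of_int (if k = i then 1 else 0) * b k $ j)" for j
  proof -
    have "(\<Sum>k<d. of_int (if k = i then 1 else 0) * b k $ j) = (\<Sum>k<d. if k = i then b k $ j else 0)"
      by (rule sum.cong) auto
    then show ?thesis using i by simp
  qed
  then have "b i = int_comb d b (\<lambda>k. if k = i then 1 else 0)"
    using i by (intro eq_vecI) (auto simp: int_comb_def)
  then show ?thesis by (auto simp: int_span_def)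
qed

lemma int_span_scale:
  "int_span d (\<lambda>i. vec d (\<lambda>j. \<xi> $ j * b i $ j)) = (\<lambda>x. vec d (\<lambda>j. \<xi> $ j * x $ j)) ` int_span d b"
proof -
  have "int_comb d (\<lambda>i. vec d (\<lambda>j. \<xi> $ j * b i $ j)) c = vec d (\<lambda>j. \<xi> $ j * int_comb d b c $ j)" for c
    by (rule eq_vecI) (auto simp: int_comb_def sum_distrib_left mult_ac)
  then show ?thesis by (auto simp: int_span_def)
qed

lemma embedding_mat_scale:
  "embedding_mat d (\<lambda>i. vec d (\<lambda>j. \<xi> $ j * b i $ j)) = embedding_mat d b * cdiag d \<xi>"
  unfolding mat_diag_mult_right[OF embedding_mat_carrier]
  by (rule eq_matI) (auto simp: embedding_mat_def)

section \<open>Lattices of roots of congruences\<close>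

context monogenic_field
begin

text \<open>The numbers \<open>c i\<close> are the coefficients of a polynomial of degree below
  \<open>d\<close> that vanishes at \<open>d\<close> distinct points. Complex coefficients are
  allowed, since the converse direction starts from a matrix with complex entries.\<close>

lemma power_independent:
  assumes z: "\<And>j. j < d \<Longrightarrow> (\<Sum>i<d. c i * \<alpha> $ j ^ (d - 1 - i)) = (0::complex)" and i: "i < d"
  shows "c i = 0"
proof -
  define p where "p = (\<Sum>i<d. Polynomial.monom (c i) (d - 1 - i))"
  have "degree p \<le> d - 1"
    unfolding p_def by (rule degree_sum_le) (auto intro: order.trans[OF degree_monom_le])
  then have deg: "degree p < d" using d_pos by simp
  have card: "card ((\<lambda>j. \<alpha> $ j) ` {..<d}) = d"
    using bij_betw_same_card[OF roots] roots by (simp add: bij_betw_def)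
  have "p = 0"
    by (rule poly_eqI_degree[of "(\<lambda>j. \<alpha> $ j) ` {..<d}"])
      (use z deg d_pos in \<open>auto simp: p_def poly_sum poly_monom card\<close>)
  then have "0 = Polynomial.coeff p (d - 1 - i)" by simp
  also have "\<dots> = (\<Sum>k<d. if k = i then c k else 0)"
    unfolding p_def coeff_sum coeff_monom using i by (intro sum.cong) auto
  also have "\<dots> = c i" using i by simp
  finally show ?thesis by simp
qed

lemma power_basis_index: "i < d \<Longrightarrow> j < d \<Longrightarrow> power_basis \<alpha> i $ j = \<alpha> $ j ^ (d - 1 - i)"
  by (simp add: power_basis_def dim_alpha)

text \<open>This is a Vandermonde determinant; a kernel vector of the transpose would be a relation
  excluded by \<open>power_independent\<close>.\<close>

lemma det_power_basis: "det (embedding_mat d (power_basis \<alpha>)) \<noteq> 0"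
proof
  let ?B = "embedding_mat d (power_basis \<alpha>)"
  assume "det ?B = 0"
  then have "det (transpose_mat ?B) = 0" by (simp add: det_transpose[OF embedding_mat_carrier])
  then obtain v where v: "v \<in> carrier_vec d" "v \<noteq> 0\<^sub>v d" and z: "transpose_mat ?B *\<^sub>v v = 0\<^sub>v d"
    using det_0_iff_vec_prod_zero[of "transpose_mat ?B" d] by auto
  have "(\<Sum>i<d. v $ i * \<alpha> $ j ^ (d - 1 - i)) = 0" if "j < d" for j
  proof -
    have "(\<Sum>i<d. v $ i * \<alpha> $ j ^ (d - 1 - i)) = (transpose_mat ?B *\<^sub>v v) $ j"
      using that v(1) by (auto simp: embedding_mat_def scalar_prod_def power_basis_index lessThan_atLeast0
          intro!: sum.cong)
    then show ?thesis using z that by simp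
  qed
  then have "v $ i = 0" if "i < d" for i
    by (rule power_independent) (use that in auto)
  then have "v = 0\<^sub>v d" using v(1) by (intro eq_vecI) auto
  with v(2) show False ..
qed

text \<open>Row \<open>i\<close> of \<open>root_mat d m \<mu>\<close> read as a polynomial in
  \<alpha>. All these polynomials take values divisible by \<open>m\<close> at \<mu>.\<close>

definition root_poly :: "int \<Rightarrow> int \<Rightarrow> nat \<Rightarrow> int poly" where
  "root_poly m \<mu> i = (if i = d - 1 then [:m:] else Polynomial.monom 1 (d - 1 - i) - [:\<mu> ^ (d - 1 - i):])"

lemma root_basis_ev:
  assumes i: "i < d"
  shows "int_comb d (power_basis \<alpha>) (\<lambda>j. root_mat d m \<mu> $$ (i, j)) = ev (root_poly m \<mu> i)"
proof (rule eq_vecI)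
  fix j assume "j < dim_vec (ev (root_poly m \<mu> i))"
  then have j: "j < d" by simp
  have "int_comb d (power_basis \<alpha>) (\<lambda>j. root_mat d m \<mu> $$ (i, j)) $ j =
      (\<Sum>k<d. of_int (root_mat d m \<mu> $$ (i, k)) * \<alpha> $ j ^ (d - 1 - k))"
    using j by (simp add: int_comb_def power_basis_index)
  also have "\<dots> = (\<Sum>k<d. (if k = d - 1 then of_int (if i = d - 1 then m else - (\<mu> ^ (d - 1 - i))) else 0) +
      (if k = i then if i = d - 1 then 0 else \<alpha> $ j ^ (d - 1 - i) else 0))"
    using i by (intro sum.cong) (auto simp: root_mat_def)
  also have "\<dots> = ev (root_poly m \<mu> i) $ j"
    using i j by (simp add: sum.distrib root_poly_def hom_distribs poly_monom)
  finally show "int_comb d (power_basis \<alpha>) (\<lambda>j. root_mat d m \<mu> $$ (i, j)) $ j = ev (root_poly m \<mu> i) $ j" .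
qed (simp add: int_comb_def)

lemma int_comb_ev:
  assumes "\<And>i. i < d \<Longrightarrow> b i = ev (f i)"
  shows "int_comb d b c = ev (\<Sum>i<d. smult (c i) (f i))"
  by (rule eq_vecI) (auto simp: int_comb_def assms hom_distribs poly_sum)

lemma root_lattice_int_span:
  "root_lattice \<alpha> m \<mu> = range (\<lambda>c. ev (\<Sum>i<d. smult (c i) (root_poly m \<mu> i)))"
  unfolding root_lattice_def dim_alpha Let_def int_span_def
  by (simp add: int_comb_ev[OF root_basis_ev])

lemma poly_degree_expansion:
  fixes r :: "int poly"
  assumes "degree r < d"
  shows "(\<Sum>i<d. Polynomial.monom (Polynomial.coeff r (d - 1 - i)) (d - 1 - i)) = r"
proof -
  have "(\<Sum>i<d. Polynomial.monom (Polynomial.coeff r (d - Suc i)) (d - Suc i)) = (\<Sum>i<d. Polynomial.monom (Polynomial.coeff r i) i)"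
    by (rule sum.nat_diff_reindex)
  also have "\<dots> = (\<Sum>i\<le>d - 1. Polynomial.monom (Polynomial.coeff r i) i)"
    using d_pos by (intro sum.cong) auto
  also have "\<dots> = r" by (rule poly_as_sum_of_monoms') (use assms in simp)
  finally show ?thesis by simp
qed

text \<open>The right-hand side comes from the kernel of the evaluation Z[X] -> Z/m at \<mu>, which
  makes the ideal property and the cyclic quotient visible. To reach it from the basis, reduce
  modulo \<open>F\<close>, which preserves divisibility at \<mu>, and expand the remainder.\<close>

lemma root_lattice_eq:
  assumes m: "m \<noteq> 0" and dvd_F: "m dvd poly F \<mu>"
  shows "root_lattice \<alpha> m \<mu> = {ev p | p. m dvd poly p \<mu>}"
proof (intro equalityI subsetI)
  fix x assume "x \<in> root_lattice \<alpha> m \<mu>"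
  then obtain c where x: "x = ev (\<Sum>i<d. smult (c i) (root_poly m \<mu> i))"
    unfolding root_lattice_int_span by blast
  have "m dvd poly (\<Sum>i<d. smult (c i) (root_poly m \<mu> i)) \<mu>"
    unfolding poly_sum by (rule dvd_sum) (auto simp: root_poly_def poly_monom)
  then show "x \<in> {ev p | p. m dvd poly p \<mu>}" using x by blast
next
  fix x assume "x \<in> {ev p | p. m dvd poly p \<mu>}"
  then obtain p where x: "x = ev p" and p: "m dvd poly p \<mu>" by blast
  have F0: "F \<noteq> 0" using monic_F by auto
  obtain q r where qr: "pseudo_divmod p F = (q, r)" by fastforce
  \<comment> \<open>Pseudo-division by a monic polynomial is genuine division.\<close>
  have eq: "p = F * q + r" using pseudo_divmod(1)[OF F0 qr] monic_F by simp
  have deg: "degree r < d" using pseudo_divmod(2)[OF F0 qr] degree_F d_pos by auto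
  have ev_eq: "ev p = ev r" unfolding eq by (rule eq_vecI) (auto simp: hom_distribs root)
  have "m dvd poly r \<mu>" using p dvd_F unfolding eq by (simp add: dvd_add_right_iff)
  then obtain k where k: "poly r \<mu> = m * k" by auto
  define e where "e i = Polynomial.coeff r (d - 1 - i)" for i
  have r: "(\<Sum>i<d. Polynomial.monom (e i) (d - 1 - i)) = r"
    unfolding e_def by (rule poly_degree_expansion[OF deg])
  have "poly r \<mu> = (\<Sum>i<d. e i * \<mu> ^ (d - 1 - i))"
    by (subst r[symmetric]) (simp add: poly_sum poly_monom)
  then have r\<mu>: "(\<Sum>i<d. [:e i * \<mu> ^ (d - 1 - i):]) = [:m * k:]"
    unfolding k[symmetric] by (simp add: hom_distribs sum_to_poly)
  \<comment> \<open>The coefficients of \<open>r\<close> serve for all rows but the last. The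
    constants subtracted there add up to r(\<mu>) = m k, and \<open>k\<close> times the last row
    restores it; the term of index \<open>d - 1\<close> in the first two sums cancels.\<close>
  have "(\<Sum>i<d. smult (if i = d - 1 then k else e i) (root_poly m \<mu> i)) =
      (\<Sum>i<d. Polynomial.monom (e i) (d - 1 - i) - [:e i * \<mu> ^ (d - 1 - i):] + (if i = d - 1 then [:m * k:] else 0))"
    by (intro sum.cong)
      (auto simp: root_poly_def smult_diff_right smult_monom monom_0 mult.commute)
  also have "\<dots> = r"
    using d_pos by (simp add: sum.distrib sum_subtractf r[simplified] r\<mu>[simplified])
  finally have "x = ev (\<Sum>i<d. smult (if i = d - 1 then k else e i) (root_poly m \<mu> i))"
    using x ev_eq by simp
  then show "x \<in> root_lattice \<alpha> m \<mu>"
    unfolding root_lattice_int_span by (rule range_eqI[where x = "\<lambda>i. if i = d - 1 then k else e i"])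
qed

lemma ideal_root_lattice:
  assumes m: "m \<noteq> 0" and dvd_F: "m dvd poly F \<mu>"
  shows "ideal (root_lattice \<alpha> m \<mu>) \<O>"
  unfolding ideal_order_iff root_lattice_eq[OF assms]
proof (intro conjI ballI allI)
  let ?L = "{ev p | p. m dvd poly p \<mu>}"
  show "?L \<subseteq> range ev" by blast
  have "ev 0 \<in> ?L" by (intro CollectI exI[of _ 0]) simp
  then show "0\<^sub>v d \<in> ?L" by (simp add: ev_0)
  fix x y assume "x \<in> ?L"
  then obtain p where p: "x = ev p" "m dvd poly p \<mu>" by blast
  show "- x \<in> ?L" using p by (auto simp flip: ev_uminus intro!: exI[of _ "- p"])
  show "pmul (ev q) x \<in> ?L" for q
    using p by (intro CollectI exI[of _ "q * p"]) (simp add: ev_mult)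
  assume "y \<in> ?L"
  then obtain q where q: "y = ev q" "m dvd poly q \<mu>" by blast
  show "x + y \<in> ?L" using p q by (intro CollectI exI[of _ "p + q"]) (simp add: ev_add)
qed

text \<open>Since p - p(\<mu>) vanishes at \<mu>, every p(\<alpha>) lies in the coset of the integer
  p(\<mu>). The quotient is thus an image of the additive group of integers.\<close>

lemma cyclic_quotient_root_lattice:
  assumes m: "m \<noteq> 0" and dvd_F: "m dvd poly F \<mu>"
  shows "cyclic_group (add_monoid (\<O> Quot root_lattice \<alpha> m \<mu>))"
proof -
  let ?L = "root_lattice \<alpha> m \<mu>"
  let ?h = "\<lambda>n. ?L +>\<^bsub>\<O>\<^esub> ev [:n:]"
  interpret ideal ?L \<O> by (rule ideal_root_lattice[OF assms])
  interpret O: cring \<O> by (rule cring_order)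
  have ev_in: "ev p \<in> carrier \<O>" for p by (simp add: carrier_order)
  have "?L +>\<^bsub>\<O>\<^esub> ev p = ?h (poly p \<mu>)" for p
  proof -
    have "ev p \<ominus>\<^bsub>\<O>\<^esub> ev [:poly p \<mu>:] = ev (p - [:poly p \<mu>:])"
      using ev_in by (auto simp: a_minus_def uminus_order order_ops hom_distribs)
    also have "\<dots> \<in> ?L"
      unfolding root_lattice_eq[OF assms] by (intro CollectI exI[of _ "p - [:poly p \<mu>:]"]) simp
    finally show ?thesis
      using quotient_eq_iff_same_a_r_cos[OF ideal_axioms ev_in ev_in] by blast
  qed
  then have "range ?h = carrier (\<O> Quot ?L)"
    unfolding FactRing_def A_RCOSETS_def' by (auto simp: carrier_order)
  moreover have "?h (x + y) = ?h x <+>\<^bsub>\<O>\<^esub> ?h y" for x y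
    unfolding a_rcos_sum[OF ev_in ev_in] order_ops ev_add[symmetric] by simp
  ultimately have "?h \<in> epi integer_group (add_monoid (\<O> Quot ?L))"
    by (auto simp: epi_def hom_def FactRing_def)
  moreover have "group (add_monoid (\<O> Quot ?L))"
    using ring.is_abelian_group[OF quotient_is_ring] abelian_group.a_group by blast
  ultimately show ?thesis
    using group.cyclic_group_epimorphic_image[OF group_integer_group] cyclic_integer_group by blast
qed

end

section \<open>Root matrices, signs of determinants and changes of representative\<close>

lemma root_mat_carrier [simp]: "root_mat d m \<mu> \<in> carrier_mat d d"
  by (simp add: root_mat_def)

lemma det_root_mat: "d > 0 \<Longrightarrow> det (root_mat d m \<mu>) = m"
proof -
  assume d: "d > 0"
  have "det (root_mat d m \<mu>) = (\<Prod>i<d. if i = d - 1 then m else 1)"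
  proof -
    have "det (root_mat d m \<mu>) = prod_list (diag_mat (root_mat d m \<mu>))"
      by (rule det_upper_triangular[of _ d]) (auto simp: root_mat_def upper_triangular_def)
    also have "\<dots> = (\<Prod>i<d. if i = d - 1 then m else 1)"
      unfolding prod_list_diag_prod by (rule prod.cong) (auto simp: root_mat_def)
    finally show ?thesis .
  qed
  also have "\<dots> = m" using d by simp
  finally show ?thesis .
qed

text \<open>Powers of congruent numbers differ by multiples of \<open>m\<close>, and these are
  absorbed by adding multiples of the last row, whose only nonzero entry is
  \<open>m\<close>.\<close>

lemma root_mat_cong:
  assumes "[\<nu> = \<mu>] (mod m)"
  obtains u where "u \<in> U_group d" "root_mat d m \<nu> = u * root_mat d m \<mu>"
proof -
  define t where "t i = (\<mu> ^ (d - 1 - i) - \<nu> ^ (d - 1 - i)) div m" for i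
  have "m dvd \<mu> ^ k - \<nu> ^ k" for k
    using cong_pow[OF cong_sym[OF assms]] by (simp add: cong_iff_dvd_diff)
  then have t: "t i * m = \<mu> ^ (d - 1 - i) - \<nu> ^ (d - 1 - i)" for i by (simp add: t_def)
  have "root_mat d m \<nu> = shear d t * root_mat d m \<mu>"
    unfolding shear_mult[OF root_mat_carrier] by (rule eq_matI) (auto simp: root_mat_def t)
  then show thesis using that U_group_eq by blast
qed

text \<open>The determinants of embedding matrices are complex numbers whose \<open>sgn\<close> is a
  direction. Cancelling the common direction turns an identity of determinants into one of real
  numbers, where signs can be compared.\<close>

lemma cmod_eq_of_sgn_eq:
  fixes a b :: complex and e x t :: real
  assumes "of_real x * a = of_real e * b * of_real t" "sgn a = sgn b" "a \<noteq> 0" "t \<ge> 0"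
  shows "x * cmod a = e * (cmod b * t)"
proof -
  have polar: "of_real y * z = of_real (y * cmod z) * sgn z" for y :: real and z :: complex
    by (cases "z = 0") (auto simp: sgn_eq)
  have "of_real x * a = of_real (e * t) * b" using assms(1) by (simp add: mult_ac)
  then have "of_real (x * cmod a) * sgn a = of_real (e * t * cmod b) * sgn b"
    unfolding polar[of x a] polar[of "e * t" b] .
  then have "of_real (x * cmod a) * sgn a = of_real (e * (cmod b * t)) * sgn a"
    unfolding assms(2) by (simp only: mult_ac)
  then have "(of_real (x * cmod a) :: complex) = of_real (e * (cmod b * t))"
    using assms(3) by (simp add: sgn_zero_iff del: of_real_mult)
  then show ?thesis by (simp only: of_real_eq_iff)
qed

lemma double_cosets_U_mult:
  assumes d: "d = r1 + 2 * r2" and B: "B \<in> carrier_mat d d" "det B \<noteq> 0"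
    and D: "D \<in> double_cosets r1 r2 B" and \<gamma>: "\<gamma> \<in> D" and u: "u \<in> U_group d"
  shows "u * \<gamma> \<in> D"
proof -
  have "\<gamma> \<in> SL d" using double_cosets_eq(1)[OF d B D \<gamma>] .
  then have "u * \<gamma> * 1\<^sub>m d = u * \<gamma>"
    using U_group_SL[OF u] by (intro right_mult_one_mat[of _ d d]) (auto simp: SL_def)
  then show ?thesis
    using double_cosets_eq(2)[OF d B D \<gamma>] one_unit_group[OF d B] u by (metis (mono_tags, lifting) mem_Collect_eq)
qed

lemma double_cosets_mem:
  assumes d: "d = r1 + 2 * r2" and B: "B \<in> carrier_mat d d" "det B \<noteq> 0" and \<gamma>: "\<gamma> \<in> SL d"
  obtains D where "D \<in> double_cosets r1 r2 B" "\<gamma> \<in> D"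
proof -
  have "1\<^sub>m d * \<gamma> * 1\<^sub>m d = \<gamma>" using SL_carrier[OF \<gamma>] by (simp add: right_mult_one_mat[of _ d d])
  then have "\<gamma> \<in> {u * \<gamma> * g | u g. u \<in> U_group d \<and> g \<in> unit_group r1 r2 B}"
    using one_unit_group[OF d B] one_U_group by (metis (mono_tags, lifting) mem_Collect_eq)
  moreover have "{u * \<gamma> * g | u g. u \<in> U_group d \<and> g \<in> unit_group r1 r2 B} \<in> double_cosets r1 r2 B"
    using \<gamma> unfolding double_cosets_def d by blast
  ultimately show thesis using that by blast
qed

text \<open>Replacing \<mu> by a congruent number multiplies the matrix identity on the left by an
  element of U, and the double coset absorbs it.\<close>

lemma parametrizes_U_mult:
  assumes d: "d = r1 + 2 * r2" and B: "B \<in> carrier_mat d d" "det B \<noteq> 0" and B1: "B1 \<in> carrier_mat d d"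
    and D: "D \<in> double_cosets r1 r2 B" and cong: "[\<nu> = \<mu>] (mod m)"
    and p: "parametrizes r1 r2 B1 B D m \<mu>"
  shows "parametrizes r1 r2 B1 B D m \<nu>"
proof -
  note assoc = assoc_mult_mat[of _ d d _ d _ d] square_mult_carrier[of _ d]
  obtain \<gamma> \<xi> where \<gamma>: "\<gamma> \<in> D" and \<xi>: "\<xi> \<in> C_plus r1 r2"
    and eq: "cmat (root_mat d m \<mu>) * B1 = cmat \<gamma> * B * cdiag d \<xi>"
    using p by (auto simp: parametrizes_def d Let_def)
  obtain u where u: "u \<in> U_group d" and R: "root_mat d m \<nu> = u * root_mat d m \<mu>"
    using root_mat_cong[OF cong] by blast
  have car: "u \<in> carrier_mat d d" "\<gamma> \<in> carrier_mat d d"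
    using U_group_SL[OF u] double_cosets_eq(1)[OF d B D \<gamma>] by (simp_all add: SL_def)
  have "cmat (root_mat d m \<nu>) * B1 = cmat u * (cmat (root_mat d m \<mu>) * B1)"
    unfolding R using car B1 by (simp add: cmat_mult[of _ d] assoc)
  also have "\<dots> = cmat (u * \<gamma>) * B * cdiag d \<xi>"
    unfolding eq using car B by (simp add: cmat_mult[of _ d] assoc)
  finally show ?thesis
    using double_cosets_U_mult[OF d B D \<gamma> u] \<xi> by (auto simp: parametrizes_def d Let_def)
qed

section \<open>Real and complex places\<close>

locale monogenic_field_places = monogenic_field +
  fixes r1 r2 :: nat
  assumes r1_eq: "r1 = card {z \<in> \<real>. poly (map_poly of_int F) (z :: complex) = 0}"
    and d_eq: "d = r1 + 2 * r2" and alpha_C_space: "\<alpha> \<in> C_space r1 r2"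
begin

abbreviation "\<V> \<equiv> embedding_mat d (power_basis \<alpha>)"

lemma alpha_inj: "i < d \<Longrightarrow> j < d \<Longrightarrow> \<alpha> $ i = \<alpha> $ j \<Longrightarrow> i = j"
  using roots by (auto simp: bij_betw_def inj_on_def)

text \<open>The first \<open>r1\<close> coordinates are already \<open>r1\<close> distinct real
  roots, so a further real coordinate would exceed the number of real roots.\<close>

lemma alpha_real_iff:
  assumes j: "j < d"
  shows "\<alpha> $ j \<in> \<real> \<longleftrightarrow> j < r1"
proof
  assume real: "\<alpha> $ j \<in> \<real>"
  show "j < r1"
  proof (rule ccontr)
    assume "\<not> j < r1"
    let ?S = "{z \<in> \<real>. poly (map_poly of_int F) (z :: complex) = 0}"
    have "F \<noteq> 0" using monic_F by auto
    then have fin: "finite ?S"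
      using poly_roots_finite[of "map_poly of_int F :: complex poly"] by (auto intro: finite_subset[rotated])
    have "(\<lambda>i. \<alpha> $ i) ` insert j {..<r1} \<subseteq> ?S"
      using real j root alpha_C_space d_eq by (auto simp: C_space_def)
    then have "card ((\<lambda>i. \<alpha> $ i) ` insert j {..<r1}) \<le> card ?S" by (rule card_mono[OF fin])
    moreover have "inj_on (\<lambda>i. \<alpha> $ i) (insert j {..<r1})"
      using alpha_inj j d_eq by (intro inj_onI) (metis insert_iff lessThan_iff trans_less_add1)
    ultimately show False using \<open>\<not> j < r1\<close> r1_eq by (simp add: card_image)
  qed
qed (use alpha_C_space in \<open>auto simp: C_space_def\<close>)

text \<open>The reality and pairing conditions hold for \<alpha> and pass to every field element
  through \<open>field_cnj\<close>.\<close>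

lemma totally_positive_C_plus:
  assumes "totally_positive \<alpha> \<xi>"
  shows "\<xi> \<in> C_plus r1 r2"
proof -
  have K: "\<xi> \<in> carrier \<K>" using assms by (simp add: totally_positive_iff)
  have "\<xi> $ j \<in> \<real>" "0 < Re (\<xi> $ j)" if "j < r1" for j
    using field_real[OF K, of j] alpha_real_iff[of j] assms that d_eq by (auto simp: totally_positive_iff)
  moreover have "\<xi> $ (r1 + 2 * k + 1) = cnj (\<xi> $ (r1 + 2 * k))" if "k < r2" for k
    using that alpha_C_space d_eq by (intro field_cnj[OF K]) (auto simp: C_space_def)
  ultimately show ?thesis
    using field_carrier_vec[OF K] d_eq by (auto simp: C_plus_def C_space_def)
qed

lemma C_plus_totally_positive:
  assumes "\<xi> \<in> C_plus r1 r2" "\<xi> \<in> carrier \<K>" "\<xi> \<noteq> 0\<^sub>v d"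
  shows "totally_positive \<alpha> \<xi>"
  using assms alpha_real_iff by (auto simp: totally_positive_iff C_plus_def)

section \<open>Narrow classes and matrix identities\<close>

lemma root_basis_embedding:
  "embedding_mat d (\<lambda>i. int_comb d (power_basis \<alpha>) (\<lambda>j. root_mat d m \<mu> $$ (i, j))) = cmat (root_mat d m \<mu>) * \<V>"
  by (rule embedding_mat_int_comb[OF root_mat_carrier])

lemma root_mat_mult_index:
  "i < d \<Longrightarrow> j < d \<Longrightarrow> (cmat (root_mat d m \<mu>) * \<V>) $$ (i, j) = ev (root_poly m \<mu> i) $ j"
  unfolding root_basis_embedding[symmetric] using root_basis_ev[of i m \<mu>] by (simp add: embedding_mat_def)

lemma narrow_rel_root_lattice:
  assumes J: "invertible_fractional_ideal \<alpha> J" and b: "int_span d b = J"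
    and \<gamma>: "\<gamma> \<in> SL d" and \<xi>: "\<xi> \<in> C_plus r1 r2" and m: "m \<noteq> 0" and F\<mu>: "m dvd poly F \<mu>"
    and eq: "cmat (root_mat d m \<mu>) * \<V> = cmat \<gamma> * embedding_mat d b * cdiag d \<xi>"
  shows "(J, root_lattice \<alpha> m \<mu>) \<in> narrow_rel \<alpha>"
proof -
  let ?L = "root_lattice \<alpha> m \<mu>"
  let ?rb = "\<lambda>i. int_comb d (power_basis \<alpha>) (\<lambda>j. root_mat d m \<mu> $$ (i, j))"
  have "embedding_mat d ?rb = cmat \<gamma> * embedding_mat d (\<lambda>i. pmul \<xi> (b i))"
    unfolding root_basis_embedding eq pmul_def embedding_mat_scale
    using SL_carrier[OF \<gamma>] by (simp add: assoc_mult_mat[of _ d d _ d _ d])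
  then have "int_span d ?rb = int_span d (\<lambda>i. pmul \<xi> (b i))" by (rule int_span_SL[OF \<gamma>])
  then have L: "?L = pmul \<xi> ` J"
    unfolding pmul_def[abs_def] int_span_scale b by (simp add: root_lattice_def dim_alpha Let_def)
  have LK: "?L \<subseteq> carrier \<K>"
    unfolding root_lattice_eq[OF m F\<mu>] using order_subset_field carrier_order by blast
  have "J \<subseteq> carrier \<K>" and "\<exists>x\<in>J. x \<noteq> 0\<^sub>v d"
    using J by (auto simp: invertible_fractional_ideal_def fractional_ideal_iff)
  then obtain x where x: "x \<in> J" "x \<noteq> 0\<^sub>v d" "x \<in> carrier \<K>" by blast
  have \<xi>vec: "\<xi> \<in> carrier_vec d" using C_plus_carrier[OF \<xi>] d_eq by simp
  \<comment> \<open>So far \<xi> is only a complex vector. It is recovered as the quotient of \<xi>x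
    by x, both of which lie in the field.\<close>
  have "pmul \<xi> x \<in> carrier \<K>" using x(1) L LK by blast
  then have "pmul (pinv x) (pmul x \<xi>) \<in> carrier \<K>"
    using pinv_field[OF x(3,2)] by (simp add: field_closed pmul_commute[of x])
  then have \<xi>K: "\<xi> \<in> carrier \<K>" using pmul_pinv[OF x(3,2) \<xi>vec] by simp
  \<comment> \<open>The lattice \<xi>J contains the nonzero integer \<open>m\<close>.\<close>
  have "\<xi> \<noteq> 0\<^sub>v d"
  proof
    assume "\<xi> = 0\<^sub>v d"
    then have "pmul \<xi> y = 0\<^sub>v d" for y by auto
    then have "?L \<subseteq> {0\<^sub>v d}" using L by auto
    moreover have "ev [:m:] \<in> ?L" unfolding root_lattice_eq[OF m F\<mu>] by (intro CollectI exI[of _ "[:m:]"]) simp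
    ultimately have "ev [:m:] = 0\<^sub>v d" by blast
    then have "ev [:m:] $ 0 = 0" using d_pos by simp
    then show False using m d_pos by (simp add: hom_distribs)
  qed
  then have "totally_positive \<alpha> \<xi>" using C_plus_totally_positive[OF \<xi> \<xi>K] by simp
  then show ?thesis
    unfolding narrow_rel_iff using J L invertible_fractional_ideal_scale[OF J \<xi>K] \<open>\<xi> \<noteq> 0\<^sub>v d\<close> by auto
qed

lemma narrow_rel_imp_root_mat:
  assumes rel: "(J, root_lattice \<alpha> m \<mu>) \<in> narrow_rel \<alpha>" and b: "int_span d b = J"
    and sgn: "sgn (det (embedding_mat d b)) = sgn (det \<V>)" and m: "m > 0"
  obtains \<gamma> \<xi> where "\<gamma> \<in> SL d" "\<xi> \<in> C_plus r1 r2"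
    "cmat (root_mat d m \<mu>) * \<V> = cmat \<gamma> * embedding_mat d b * cdiag d \<xi>"
proof -
  note assoc = assoc_mult_mat[of _ d d _ d _ d]
  let ?rb = "\<lambda>i. int_comb d (power_basis \<alpha>) (\<lambda>j. root_mat d m \<mu> $$ (i, j))"
  obtain \<xi> where \<xi>: "totally_positive \<alpha> \<xi>" and L: "root_lattice \<alpha> m \<mu> = pmul \<xi> ` J"
    using rel by (auto simp: narrow_rel_iff)
  have C: "\<xi> \<in> C_plus r1 r2" by (rule totally_positive_C_plus[OF \<xi>])
  let ?sb = "\<lambda>i. pmul \<xi> (b i)"
  have spans: "int_span d ?rb = int_span d ?sb"
    using L unfolding pmul_def[abs_def] int_span_scale b by (simp add: root_lattice_def dim_alpha Let_def)
  obtain M where M: "M \<in> carrier_mat d d" "embedding_mat d ?rb = cmat M * embedding_mat d ?sb"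
    using int_span_transition[of d ?rb ?sb] int_span_basis_mem[of _ d ?rb] spans by auto
  obtain M' where M': "M' \<in> carrier_mat d d" "embedding_mat d ?sb = cmat M' * embedding_mat d ?rb"
    using int_span_transition[of d ?sb ?rb] int_span_basis_mem[of _ d ?sb] spans by auto
  have sb: "embedding_mat d ?sb = embedding_mat d b * cdiag d \<xi>"
    unfolding pmul_def by (rule embedding_mat_scale)
  have eq: "cmat (root_mat d m \<mu>) * \<V> = cmat M * embedding_mat d b * cdiag d \<xi>"
    using M unfolding root_basis_embedding sb by (simp add: assoc)
  let ?r = "det (embedding_mat d ?rb)"
  have r: "?r = of_int m * det \<V>"
    unfolding root_basis_embedding using d_pos by (simp add: det_mult[of _ d] det_root_mat)
  then have rnz: "?r \<noteq> 0" using m det_power_basis by simp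
  \<comment> \<open>Passing from one basis to the other and back multiplies the determinant by
    \<open>det M * det M'\<close>, so both integers are units.\<close>
  have "?r = of_int (det M) * (of_int (det M') * ?r)"
    using arg_cong[OF M(2), of det] arg_cong[OF M'(2), of det] M(1) M'(1)
    by (simp add: det_mult[of _ d])
  then have "of_int (det M * det M') * ?r = 1 * ?r" by simp
  then have "complex_of_int (det M * det M') = 1" using rnz by (simp only: mult_cancel_right) simp
  then have unit: "det M * det M' = 1" by (simp only: of_int_eq_1_iff)
  obtain t where t: "t \<ge> 0" "(\<Prod>j<d. \<xi> $ j) = of_real t" using prod_C_plus[OF C] d_eq by metis
  \<comment> \<open>By hypothesis the two determinants have the same direction, and \<open>m\<close>
    is positive; this excludes \<open>det M = -1\<close>.\<close>
  have "of_real (of_int m) * det \<V> = of_real (of_int (det M)) * det (embedding_mat d b) * of_real t"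
    using arg_cong[OF eq, of det] M(1) d_pos t(2)
    by (simp add: det_mult[of _ d] square_mult_carrier[of _ d] det_mat_diag det_root_mat)
  from cmod_eq_of_sgn_eq[OF this sgn[symmetric] det_power_basis t(1)]
  have "real_of_int (det M) * (cmod (det (embedding_mat d b)) * t) = real_of_int m * cmod (det \<V>)" by simp
  also have "\<dots> > 0" using m det_power_basis by simp
  finally have "0 < real_of_int (det M)" 
    using mult_nonneg_nonneg[OF norm_ge_zero t(1), of "det (embedding_mat d b)"]
    by (metis zero_less_mult_iff not_less)
  then have "det M = 1" using unit by (simp add: pos_zmult_eq_1_iff)
  then show thesis using that[OF _ C eq] M(1) by (simp add: SL_def)
qed

section \<open>From a matrix with prescribed columns to a root modulo m\<close>

lemma C_plus_zero_pair:
  assumes \<xi>: "\<xi> \<in> C_plus r1 r2" and j: "j < d" "\<xi> $ j = 0"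
  obtains j' where "j' < d" "j' \<noteq> j" "\<xi> $ j' = 0"
proof -
  \<comment> \<open>A zero can only sit at a complex place, and then the conjugate coordinate
    vanishes too.\<close>
  have "\<not> j < r1" using \<xi> j by (auto simp: C_plus_def)
  define k where "k = (j - r1) div 2"
  have k: "k < r2" "j = r1 + 2 * k \<or> j = r1 + 2 * k + 1"
    using \<open>\<not> j < r1\<close> j d_eq by (auto simp: k_def)
  have c: "\<xi> $ (r1 + 2 * k + 1) = cnj (\<xi> $ (r1 + 2 * k))" using \<xi> k(1) by (auto simp: C_plus_def C_space_def)
  from k(2) show thesis
  proof
    assume "j = r1 + 2 * k"
    then show thesis using c j k(1) d_eq by (intro that[of "r1 + 2 * k + 1"]) auto
  next
    assume "j = r1 + 2 * k + 1"
    then show thesis using c j k(1) d_eq by (intro that[of "r1 + 2 * k"]) auto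
  qed
qed

text \<open>The last column of \<open>N\<close> is arbitrary complex at first; its integrality comes
  from the stability of the lattice \<xi>J under \<alpha>. That column is determined only modulo
  \<open>m\<close>, which is the reason for the factor \<open>u\<close>. The argument rests on row
  \<open>d - 2\<close>, that is \<alpha> plus a constant, hence \<open>2 \<le> d\<close>.\<close>

lemma root_mat_of_near_identity:
  assumes d2: "2 \<le> d" and J: "invertible_fractional_ideal \<alpha> J" and b: "int_span d b = J"
    and sgn: "sgn (det (embedding_mat d b)) = sgn (det \<V>)"
    and \<gamma>: "\<gamma> \<in> SL d" and \<xi>: "\<xi> \<in> C_plus r1 r2" and N: "N \<in> carrier_mat d d"
    and cols: "\<And>i j. i < d \<Longrightarrow> j < d - 1 \<Longrightarrow> N $$ (i, j) = 1\<^sub>m d $$ (i, j)"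
    and eq: "cmat \<gamma> * embedding_mat d b * cdiag d \<xi> = N * \<V>"
  obtains m \<mu> u where "m > 0" "m dvd poly F \<mu>" "u \<in> U_group d"
    "cmat (u * \<gamma>) * embedding_mat d b * cdiag d \<xi> = cmat (root_mat d m \<mu>) * \<V>"
proof -
  note assoc = assoc_mult_mat[of _ d d _ d _ d]
  note car = SL_carrier[OF \<gamma>]
  define n where "n i = N $$ (i, d - 1)" for i
  define row where "row i = vec d (\<lambda>j. (if i < d - 1 then \<alpha> $ j ^ (d - 1 - i) else 0) + n i)" for i
  define L where "L = pmul \<xi> ` J"
  have NB: "(N * \<V>) $$ (i, j) = row i $ j" if ij: "i < d" "j < d" for i j
  proof -
    have "(N * \<V>) $$ (i, j) = (\<Sum>k<d. N $$ (i, k) * \<alpha> $ j ^ (d - 1 - k))"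
      using ij N by (auto simp: scalar_prod_def embedding_mat_def power_basis_index lessThan_atLeast0 intro!: sum.cong)
    also have "\<dots> = (\<Sum>k<d. (if k = i then (if i < d - 1 then \<alpha> $ j ^ (d - 1 - i) else 0) else 0) +
        (if k = d - 1 then n i else 0))"
    proof (rule sum.cong[OF refl])
      fix k assume "k \<in> {..<d}"
      then have "k < d - 1 \<or> k = d - 1" by auto
      then show "N $$ (i, k) * \<alpha> $ j ^ (d - 1 - k) =
          (if k = i then (if i < d - 1 then \<alpha> $ j ^ (d - 1 - i) else 0) else 0) + (if k = d - 1 then n i else 0)"
        using cols[of i k] ij by (auto simp: n_def)
    qed
    also have "\<dots> = row i $ j" using ij by (simp add: sum.distrib row_def)
    finally show ?thesis .
  qed
  have row_mat: "embedding_mat d row = N * \<V>"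
    by (rule eq_matI) (use N NB in \<open>auto simp: embedding_mat_def\<close>)
  also have "\<dots> = cmat \<gamma> * embedding_mat d (\<lambda>i. pmul \<xi> (b i))"
    unfolding eq[symmetric] pmul_def embedding_mat_scale using car by (simp add: assoc)
  finally have "int_span d row = int_span d (\<lambda>i. pmul \<xi> (b i))" by (rule int_span_SL[OF \<gamma>])
  also have "\<dots> = L" unfolding pmul_def[abs_def] int_span_scale b L_def ..
  finally have span: "int_span d row = L" .
  have row_L: "row i \<in> L" if "i < d" for i
    using int_span_basis_mem[OF that, of row] span by (simp add: row_def)
  have J_props: "\<And>x y. x \<in> J \<Longrightarrow> y \<in> J \<Longrightarrow> x + y \<in> J" "\<And>x. x \<in> J \<Longrightarrow> - x \<in> J"
    "\<And>p x. x \<in> J \<Longrightarrow> pmul (ev p) x \<in> J"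
    using J by (auto simp: invertible_fractional_ideal_def fractional_ideal_iff)
  note J_vec = invertible_fractional_ideal_vec[OF J]
  have L_add: "x + y \<in> L" if "x \<in> L" "y \<in> L" for x y
    using that J_props(1) J_vec by (auto simp: L_def simp flip: pmul_add)
  have L_neg: "- x \<in> L" if "x \<in> L" for x
    using that J_props(2) J_vec by (auto simp: L_def simp flip: pmul_uminus)
  have L_mul: "pmul (ev p) x \<in> L" if "x \<in> L" for p x
    using that J_props(3) by (auto simp: L_def pmul_left_commute[of _ \<xi>])

  \<comment> \<open>Expand \<open>x\<close> in the rows and compare with its coordinates
    \<open>e\<close> in the power basis, which are unique even over the complex numbers. Row
    \<open>i\<close> contributes \<open>a i\<close> to the power of index \<open>i\<close> when
    \<open>i < d - 1\<close>, and always \<open>a i * n i\<close> to the constant term.\<close>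
  have coord: "\<exists>a :: nat \<Rightarrow> int. (\<forall>i<d - 1. e i = of_int (a i)) \<and> e (d - 1) = (\<Sum>i<d. of_int (a i) * n i)"
    if x: "x \<in> L" and e: "\<And>j. j < d \<Longrightarrow> x $ j = (\<Sum>i<d. e i * \<alpha> $ j ^ (d - 1 - i))" for x e
  proof -
    obtain a where a: "x = int_comb d row a" using x span by (auto simp: int_span_def)
    define f where "f i = e i - (if i < d - 1 then of_int (a i) else (\<Sum>i<d. of_int (a i) * n i))" for i
    have "(\<Sum>i<d. f i * \<alpha> $ j ^ (d - 1 - i)) = 0" if j: "j < d" for j
    proof -
      have "(\<Sum>i<d. (if i < d - 1 then of_int (a i) else (\<Sum>i<d. of_int (a i) * n i)) * \<alpha> $ j ^ (d - 1 - i)) =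
        (\<Sum>i<d. (if i < d - 1 then of_int (a i) * \<alpha> $ j ^ (d - 1 - i) else 0) +
          (if i = d - 1 then (\<Sum>i<d. of_int (a i) * n i) else 0))"
        by (rule sum.cong) auto
      also have "\<dots> = (\<Sum>i<d. (if i < d - 1 then of_int (a i) * \<alpha> $ j ^ (d - 1 - i) else 0)) + (\<Sum>i<d. of_int (a i) * n i)"
        using d_pos by (simp add: sum.distrib)
      also have "\<dots> = (\<Sum>i<d. of_int (a i) * row i $ j)"
        unfolding sum.distrib[symmetric] using j by (intro sum.cong) (auto simp: row_def distrib_left)
      also have "\<dots> = x $ j" using j by (simp add: a int_comb_def)
      finally show ?thesis
        unfolding f_def left_diff_distrib sum_subtractf e[OF j] by simp
    qed
    then have f0: "f i = 0" if "i < d" for i by (rule power_independent) (use that in auto)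
    have "e i = of_int (a i)" if "i < d - 1" for i using f0[of i] that by (simp add: f_def)
    moreover have "e (d - 1) = (\<Sum>i<d. of_int (a i) * n i)" using f0[of "d - 1"] d_pos by (simp add: f_def)
    ultimately show ?thesis by blast
  qed
  define c where "c = n (d - 1)"
  \<comment> \<open>For a constant the coordinates before the last vanish, hence so do the
    corresponding \<open>a i\<close>, and only the last row remains.\<close>
  have const: "\<exists>k :: int. q = of_int k * c" if qL: "vec d (\<lambda>j. q) \<in> L" for q
  proof -
    obtain a :: "nat \<Rightarrow> int" where a: "\<And>i. i < d - 1 \<Longrightarrow> (if i = d - 1 then q else 0) = of_int (a i)"
      and q: "q = (\<Sum>i<d. of_int (a i) * n i)"
      using coord[OF qL, of "\<lambda>i. if i = d - 1 then q else 0"] d_pos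
      by (auto simp: if_distrib[of "\<lambda>x. x * _"] cong: if_cong)
    have "(\<Sum>i<d. of_int (a i) * n i) = (\<Sum>i<d. if i = d - 1 then of_int (a (d - 1)) * n (d - 1) else 0)"
    proof (rule sum.cong[OF refl])
      fix i assume "i \<in> {..<d}"
      then have "i < d - 1 \<or> i = d - 1" by auto
      then show "of_int (a i) * n i = (if i = d - 1 then of_int (a (d - 1)) * n (d - 1) else 0)"
        using a[of i] by auto
    qed
    then show ?thesis using q d_pos by (intro exI[of _ "a (d - 1)"]) (simp add: c_def)
  qed

  have row1: "row (d - 2) $ j = \<alpha> $ j + n (d - 2)" if "j < d" for j
    using that d2 by (auto simp: row_def numeral_2_eq_2)
  have \<xi>nz: "\<xi> $ j \<noteq> 0" if j: "j < d" for j
  proof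
    \<comment> \<open>A zero of \<open>\<xi>\<close> comes with one at the conjugate place, and the lattice element \<open>\<alpha> + n (d - 2)\<close>
      would vanish at both of them.\<close>
    assume "\<xi> $ j = 0"
    with C_plus_zero_pair[OF \<xi> j] obtain j' where j': "j' < d" "j' \<noteq> j" "\<xi> $ j' = 0" by metis
    have "row (d - 2) \<in> L" using row_L d2 by simp
    then have "row (d - 2) $ j = 0" "row (d - 2) $ j' = 0"
      using j j' \<open>\<xi> $ j = 0\<close> by (auto simp: L_def)
    then have "\<alpha> $ j = \<alpha> $ j'" using row1[OF j] row1[OF j'(1)] by (simp add: add_eq_0_iff2)
    then show False using alpha_inj j j' by blast
  qed
  have "det N = (\<Prod>i<d. if i = d - 1 then c else 1)"
  proof -
    have "det N = prod_list (diag_mat N)"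
      by (rule det_upper_triangular[OF _ N]) (use N cols in \<open>auto simp: upper_triangular_def\<close>)
    also have "\<dots> = (\<Prod>i<d. if i = d - 1 then c else 1)"
      unfolding prod_list_diag_prod using N cols by (intro prod.cong) (auto simp: c_def n_def)
    finally show ?thesis .
  qed
  then have detN: "det N = c" using d_pos by simp
  obtain t where t: "t \<ge> 0" "(\<Prod>j<d. \<xi> $ j) = of_real t" using prod_C_plus[OF \<xi>] d_eq by metis
  \<comment> \<open>This identity serves twice: here for \<open>c \<noteq> 0\<close>, and later,
    once \<open>c\<close> is known to be an integer, for its sign.\<close>
  have det_eq: "c * det \<V> = det (embedding_mat d b) * of_real t"
    using arg_cong[OF eq, of det] car N detN t(2) \<gamma>
    by (simp add: det_mult[of _ d] square_mult_carrier[of _ d] det_mat_diag SL_def)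
  have "t \<noteq> 0" using t(2) \<xi>nz by (metis of_real_0 prod_zero_iff finite_lessThan lessThan_iff)
  moreover have "det (embedding_mat d b) \<noteq> 0" using sgn det_power_basis by (metis sgn_zero_iff)
  ultimately have "c \<noteq> 0" using det_eq by auto

  \<comment> \<open>The last row is the constant \<open>c\<close>. The coordinates of \<alpha>c are
    \<open>c\<close> at index \<open>d - 2\<close> and zero elsewhere, so \<open>coord\<close> makes
    \<open>c\<close> an integer.\<close>
  have \<alpha>c: "pmul (ev [:0, 1:]) (row (d - 1)) \<in> L" using L_mul row_L d_pos by simp
  have "pmul (ev [:0, 1:]) (row (d - 1)) $ j = (\<Sum>i<d. (if i = d - 2 then c else 0) * \<alpha> $ j ^ (d - 1 - i))"
    if "j < d" for j
  proof -
    have "(\<Sum>i<d. (if i = d - 2 then c else 0) * \<alpha> $ j ^ (d - 1 - i)) =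
        (\<Sum>i<d. if i = d - 2 then c * \<alpha> $ j ^ (d - 1 - (d - 2)) else 0)" by (rule sum.cong) auto
    also have "\<dots> = c * \<alpha> $ j ^ (d - 1 - (d - 2))" using d2 by simp
    also have "d - 1 - (d - 2) = 1" using d2 by simp
    finally show ?thesis using that by (simp add: row_def c_def hom_distribs)
  qed
  from coord[of _ "\<lambda>i. if i = d - 2 then c else 0", OF \<alpha>c this] obtain a :: "nat \<Rightarrow> int"
    where a_all: "\<forall>i<d - 1. (if i = d - 2 then c else 0) = of_int (a i)"
      and a0: "(if d - 1 = d - 2 then c else 0) = (\<Sum>i<d. of_int (a i) * n i)"
    by blast
  have a: "(if i = d - 2 then c else 0) = of_int (a i)" if "i < d - 1" for i using a_all that by blast
  have "d - 1 \<noteq> d - 2" using d2 by simp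
  define m where "m = a (d - 2)"
  define \<mu> where "\<mu> = a (d - 1)"
  have c: "c = of_int m" using a[of "d - 2"] d2 by (simp add: m_def)
  \<comment> \<open>The constant term of \<alpha>c is zero. Only the indices \<open>d - 2\<close>
    and \<open>d - 1\<close> contribute to it, which gives c (n_(d-2) + \<mu>) = 0 and turns row
    \<open>d - 2\<close> into \<alpha> - \<mu>.\<close>
  have "(\<Sum>i<d. of_int (a i) * n i) = (\<Sum>i<d. (if i = d - 2 then of_int m * n (d - 2) else 0) +
      (if i = d - 1 then of_int \<mu> * c else 0))"
  proof (rule sum.cong[OF refl])
    fix i assume "i \<in> {..<d}"
    then consider "i = d - 1" | "i = d - 2" "i < d - 1" | "i < d - 1" "i \<noteq> d - 2" "i \<noteq> d - 1" using d2 by fastforce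
    then show "of_int (a i) * n i = (if i = d - 2 then of_int m * n (d - 2) else 0) + (if i = d - 1 then of_int \<mu> * c else 0)"
      using a[of i] d2 by cases (auto simp: m_def \<mu>_def c_def)
  qed
  also have "\<dots> = c * (n (d - 2) + of_int \<mu>)" using d2 by (simp add: sum.distrib c algebra_simps)
  finally have "c * (n (d - 2) + of_int \<mu>) = 0"
    using a0 \<open>d - 1 \<noteq> d - 2\<close> by simp
  then have n2: "n (d - 2) = - of_int \<mu>" using \<open>c \<noteq> 0\<close> by (simp add: add_eq_0_iff2)

  have "of_real (of_int m) * det \<V> = of_real 1 * det (embedding_mat d b) * of_real t"
    using det_eq c by simp
  from cmod_eq_of_sgn_eq[OF this sgn[symmetric] det_power_basis t(1)]
  have "real_of_int m * cmod (det \<V>) = cmod (det (embedding_mat d b)) * t" by simp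
  also have "\<dots> > 0" using \<open>t \<noteq> 0\<close> t(1) \<open>det (embedding_mat d b) \<noteq> 0\<close> by simp
  finally have m: "m > 0" using det_power_basis by (simp add: zero_less_mult_iff)

  have lin: "row (d - 2) = ev [:- \<mu>, 1:]"
    using d2 n2 by (intro eq_vecI) (auto simp: row1 row_def hom_distribs numeral_2_eq_2)
  \<comment> \<open>The polynomial p - p(\<mu>) is a multiple of X - \<mu>, and \<alpha> - \<mu>
    lies in the lattice.\<close>
  have diff: "ev (p - [:poly p \<mu>:]) \<in> L" for p
  proof -
    have "poly (p - [:poly p \<mu>:]) \<mu> = 0" by simp
    then have "[:- \<mu>, 1:] dvd p - [:poly p \<mu>:]" by (simp only: poly_eq_0_iff_dvd)
    then obtain q where "p - [:poly p \<mu>:] = [:- \<mu>, 1:] * q" by (rule dvdE)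
    then have "ev (p - [:poly p \<mu>:]) = pmul (ev q) (row (d - 2))"
      unfolding lin by (simp add: mult.commute[of _ q] ev_mult del: mult_pCons_left mult_pCons_right)
    then show ?thesis using L_mul row_L d2 by simp
  qed
  have const_dvd: "\<exists>k. q = of_int (k * m)" if "vec d (\<lambda>j. q) \<in> L" for q
    using const[OF that] c by auto
  have "- ev (F - [:poly F \<mu>:]) \<in> L" by (rule L_neg[OF diff])
  moreover have "- ev (F - [:poly F \<mu>:]) = vec d (\<lambda>j. of_int (poly F \<mu>))"
    by (rule eq_vecI) (auto simp: hom_distribs root)
  ultimately obtain k where "complex_of_int (poly F \<mu>) = of_int (k * m)" using const_dvd by metis
  then have F\<mu>: "m dvd poly F \<mu>" by (simp only: of_int_eq_iff) simp

  \<comment> \<open>Subtracting \<alpha>^k - \<mu>^k, with k = d - 1 - i, from row \<open>i\<close>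
    leaves a constant of the lattice, hence a multiple of \<open>m\<close>.\<close>
  have "\<exists>s. n i = - of_int (\<mu> ^ (d - 1 - i)) + of_int (s * m)" if i: "i < d - 1" for i
  proof -
    let ?p = "Polynomial.monom 1 (d - 1 - i) :: int poly"
    have "row i + - ev (?p - [:poly ?p \<mu>:]) \<in> L"
      using i by (intro L_add L_neg diff row_L) simp
    moreover have "row i + - ev (?p - [:poly ?p \<mu>:]) = vec d (\<lambda>j. n i + of_int (\<mu> ^ (d - 1 - i)))"
      using i by (intro eq_vecI) (auto simp: row_def hom_distribs poly_monom)
    ultimately obtain s where "n i + of_int (\<mu> ^ (d - 1 - i)) = of_int (s * m)" using const_dvd by metis
    then show ?thesis by (intro exI[of _ s]) (simp add: algebra_simps)
  qed
  then obtain s where s: "\<And>i. i < d - 1 \<Longrightarrow> n i = - of_int (\<mu> ^ (d - 1 - i)) + of_int (s i * m)" by metis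
  have Neq: "N = cmat (shear d s * root_mat d m \<mu>)"
  proof (rule eq_matI)
    fix i j assume "i < dim_row (cmat (shear d s * root_mat d m \<mu>))" "j < dim_col (cmat (shear d s * root_mat d m \<mu>))"
    then have ij: "i < d" "j < d" by (simp_all add: shear_def root_mat_def)
    consider "j < d - 1" | "j = d - 1" "i < d - 1" | "j = d - 1" "i = d - 1" using ij by fastforce
    then show "N $$ (i, j) = cmat (shear d s * root_mat d m \<mu>) $$ (i, j)"
    proof cases
      case 1
      then show ?thesis
        unfolding shear_mult[OF root_mat_carrier] using ij cols[of i j] by (auto simp: root_mat_def)
    next
      case 2
      then show ?thesis
        unfolding shear_mult[OF root_mat_carrier] using ij s[of i] by (auto simp: root_mat_def n_def)
    next
      case 3
      then show ?thesis
        unfolding shear_mult[OF root_mat_carrier] using ij c by (auto simp: root_mat_def n_def c_def)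
    qed
  qed (use N in \<open>auto simp: shear_def root_mat_def\<close>)
  \<comment> \<open>This undoes the shear by which \<open>N\<close> differs from the root
    matrix.\<close>
  let ?u = "shear d (\<lambda>i. - s i)"
  have "cmat (?u * \<gamma>) * embedding_mat d b * cdiag d \<xi> = cmat ?u * (cmat \<gamma> * embedding_mat d b * cdiag d \<xi>)"
    using car by (simp add: cmat_mult[of _ d] assoc square_mult_carrier[of _ d])
  also have "\<dots> = cmat (?u * shear d s * root_mat d m \<mu>) * \<V>"
    unfolding eq Neq by (simp add: cmat_mult[of _ d] assoc square_mult_carrier[of _ d])
  also have "\<dots> = cmat (root_mat d m \<mu>) * \<V>" 
    by (simp add: shear_add shear_0 left_mult_one_mat[OF root_mat_carrier])
  finally show thesis by (intro that[OF m F\<mu>, of ?u]) (simp_all add: U_group_eq)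
qed

text \<open>Two identities for one double coset show that the root matrices agree up to a shear on
  the left and a diagonal matrix on the right of \<V>. The last row makes that diagonal matrix a
  scalar \<open>q\<close>, and row \<open>d - 2\<close>, compared at two distinct roots, gives q =
  1.\<close>

lemma root_mat_unique:
  assumes d2: "2 \<le> d" and B: "B \<in> carrier_mat d d" "det B \<noteq> 0"
    and D: "D \<in> double_cosets r1 r2 B" and m: "m \<noteq> 0"
    and p: "parametrizes r1 r2 \<V> B D m \<mu>" "parametrizes r1 r2 \<V> B D m' \<mu>'"
  shows "m' = m" "[\<mu>' = \<mu>] (mod m)"
proof -
  note assoc = assoc_mult_mat[of _ d d _ d _ d] square_mult_carrier[of _ d]
  obtain \<gamma> \<xi> where \<gamma>: "\<gamma> \<in> D" and \<xi>: "\<xi> \<in> C_plus r1 r2"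
    and eq: "cmat (root_mat d m \<mu>) * \<V> = cmat \<gamma> * B * cdiag d \<xi>"
    using p(1) by (auto simp: parametrizes_def d_eq Let_def)
  obtain \<gamma>' \<xi>' where \<gamma>': "\<gamma>' \<in> D" and \<xi>': "\<xi>' \<in> C_plus r1 r2"
    and eq': "cmat (root_mat d m' \<mu>') * \<V> = cmat \<gamma>' * B * cdiag d \<xi>'"
    using p(2) by (auto simp: parametrizes_def d_eq Let_def)
  have SL: "\<gamma> \<in> SL d" and D_eq: "D = {u * \<gamma> * g | u g. u \<in> U_group d \<and> g \<in> unit_group r1 r2 B}"
    by (rule double_cosets_eq[OF d_eq B D \<gamma>])+
  obtain u g where u: "u \<in> U_group d" and g: "g \<in> unit_group r1 r2 B" and \<gamma>'_eq: "\<gamma>' = u * \<gamma> * g"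
    using \<gamma>' D_eq by blast
  obtain t where t: "u = shear d t" using u U_group_eq by blast
  obtain \<eta> where gSL: "g \<in> SL d" and \<eta>: "cmat g * B = B * cdiag d \<eta>"
    using g unit_group_iff[OF d_eq B] by auto
  note car = SL_carrier[OF SL] SL_carrier[OF gSL] SL_carrier[OF U_group_SL[OF u]]
  have "det (cmat \<gamma> * B * cdiag d \<xi>) \<noteq> 0"
    unfolding eq[symmetric] using m det_power_basis d_pos by (simp add: det_mult[of _ d] det_root_mat)
  then have \<xi>nz: "\<xi> $ j \<noteq> 0" if "j < d" for j
    by (rule det_mult_cdiag_nonzero[rotated]) (use car B that in \<open>auto simp: assoc\<close>)
  \<comment> \<open>The factor \<eta> comes from moving \<open>g\<close> past \<open>B\<close>;
    \<zeta> collects everything by which the two diagonal factors differ.\<close>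
  define \<zeta> where "\<zeta> = vec d (\<lambda>j. \<eta> $ j * \<xi>' $ j / \<xi> $ j)"
  have diag: "cdiag d \<eta> * cdiag d \<xi>' = cdiag d \<xi> * cdiag d \<zeta>"
    unfolding mat_diag_diag using \<xi>nz by (auto simp: mat_diag_def \<zeta>_def)
  have "cmat (root_mat d m' \<mu>') * \<V> = cmat u * cmat \<gamma> * (cmat g * B) * cdiag d \<xi>'"
    unfolding eq' \<gamma>'_eq using car B by (simp add: cmat_mult[of _ d] assoc)
  also have "\<dots> = cmat u * cmat \<gamma> * B * (cdiag d \<eta> * cdiag d \<xi>')"
    unfolding \<eta> using car B by (simp add: assoc del: mat_diag_diag)
  also have "\<dots> = cmat u * (cmat \<gamma> * B * cdiag d \<xi>) * cdiag d \<zeta>"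
    unfolding diag using car B by (simp add: assoc del: mat_diag_diag)
  also have "\<dots> = shear d (\<lambda>i. of_int (t i)) * (cmat (root_mat d m \<mu>) * \<V>) * cdiag d \<zeta>"
    unfolding eq t cmat_shear ..
  finally have main: "cmat (root_mat d m' \<mu>') * \<V> = \<dots>" .
  have row: "ev (root_poly m' \<mu>' i) $ j =
      (ev (root_poly m \<mu> i) $ j + (if i < d - 1 then of_int (t i) * ev (root_poly m \<mu> (d - 1)) $ j else 0)) * \<zeta> $ j"
    if ij: "i < d" "j < d" for i j
  proof -
    have X: "cmat (root_mat d m \<mu>) * \<V> \<in> carrier_mat d d" by (simp add: assoc)
    show ?thesis
      using arg_cong[OF main, of "\<lambda>A. A $$ (i, j)"] ij
      unfolding shear_mult[OF X] mat_diag_mult_right[OF mat_carrier]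
      using d_pos by (simp add: root_mat_mult_index del: ev_index)
  qed
  have last: "of_int m' = of_int m * \<zeta> $ j" if "j < d" for j
    using row[of "d - 1" j] that d_pos by (simp add: root_poly_def hom_distribs)
  define q where "q = \<zeta> $ 0"
  have q: "\<zeta> $ j = q" if "j < d" for j
    using last[OF that] last[OF d_pos] m by (simp add: q_def)
  have lin: "\<alpha> $ j - of_int \<mu>' = (\<alpha> $ j - of_int \<mu> + of_int (t (d - 2)) * of_int m) * q" if "j < d" for j
  proof -
    have "d - 1 - (d - 2) = 1" "d - 2 < d - 1" "d - 2 < d" "d - 2 \<noteq> d - 1" using d2 by auto
    then show ?thesis using row[of "d - 2" j] that d_pos
      by (simp add: root_poly_def hom_distribs q poly_monom del: diff_diff_left)
  qed
  \<comment> \<open>Subtracting the equations for two roots eliminates the unknown integers.\<close>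
  have "(\<alpha> $ 0 - of_int \<mu>') - (\<alpha> $ 1 - of_int \<mu>') = (\<alpha> $ 0 - \<alpha> $ 1) * q"
    using lin[of 0] lin[of 1] d2 by (simp only: left_diff_distrib distrib_right) simp
  then have "(\<alpha> $ 0 - \<alpha> $ 1) * (1 - q) = 0" by (simp add: algebra_simps)
  moreover have "\<alpha> $ 0 \<noteq> \<alpha> $ 1" using alpha_inj[of 0 1] d2 by auto
  ultimately have q1: "q = 1" by simp
  then have "complex_of_int m' = of_int m" using last[OF d_pos] q_def by simp
  then show "m' = m" by simp
  have "complex_of_int \<mu>' = of_int (\<mu> - t (d - 2) * m)" using lin[OF d_pos] q1 by (simp add: algebra_simps)
  then have "\<mu>' = \<mu> - t (d - 2) * m" by (simp only: of_int_eq_iff)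
  then show "[\<mu>' = \<mu>] (mod m)" by (simp add: cong_iff_dvd_diff)
qed

end

text \<open>A given \<mu> selects certain representatives of a double coset, so the identity is
  asserted for some element of the coset, or after a factor from U. The converse is restricted to
  \<open>2 \<le> d\<close> because for \<open>d = 1\<close> the shape of \<open>N\<close> imposes
  nothing: any positive real \<xi> would fit, integral or not.\<close>

theorem theorem3:
  fixes F :: "int poly" and \<alpha> :: "complex vec" and d r1 r2 :: nat
    and I :: "nat \<Rightarrow> complex vec set" and \<beta> :: "nat \<Rightarrow> nat \<Rightarrow> complex vec"
    and \<BB> :: "nat \<Rightarrow> complex mat"
  assumes "irreducible F" and "lead_coeff F = 1" and "degree F = d"
    and "dim_vec \<alpha> = d"
    and "bij_betw (\<lambda>j. \<alpha> $ j) {..<d} {z. poly (map_poly of_int F) z = 0}"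
    and "r1 = card {z \<in> \<real>. poly (map_poly of_int F) (z :: complex) = 0}"
    and "d = r1 + 2 * r2"
    and "\<alpha> \<in> C_space r1 r2"
    and "\<And>l. l \<in> {1..narrow_class_number \<alpha>} \<Longrightarrow> invertible_ideal \<alpha> (I l)"
    and "bij_betw (\<lambda>l. narrow_rel \<alpha> `` {I l}) {1..narrow_class_number \<alpha>} (narrow_classes \<alpha>)"
    and "I 1 = carrier (monogenic_order \<alpha>)"
    and "\<And>l. l \<in> {1..narrow_class_number \<alpha>} \<Longrightarrow> int_basis d (\<beta> l) (I l)"
    and "\<And>i. i < d \<Longrightarrow> \<beta> 1 i = power_basis \<alpha> i"
    and "\<And>l. \<BB> l = embedding_mat d (\<beta> l)"
    and "\<And>l. l \<in> {1..narrow_class_number \<alpha>} \<Longrightarrow> sgn (det (\<BB> l)) = sgn (det (\<BB> 1))"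
  shows
    "(\<forall>m \<mu> :: int. 0 < m \<and> [poly F \<mu> = 0] (mod m) \<longrightarrow>
        ideal (root_lattice \<alpha> m \<mu>) (monogenic_order \<alpha>) \<and>
        cyclic_group (add_monoid (monogenic_order \<alpha> Quot root_lattice \<alpha> m \<mu>)) \<and>
        (invertible_ideal \<alpha> (root_lattice \<alpha> m \<mu>) \<longrightarrow>
          (\<exists>!(l, D). l \<in> {1..narrow_class_number \<alpha>} \<and> D \<in> double_cosets r1 r2 (\<BB> l) \<and>
             parametrizes r1 r2 (\<BB> 1) (\<BB> l) D m \<mu>) \<and>
          (\<forall>\<nu>. [\<nu> = \<mu>] (mod m) \<longrightarrow>
             (\<forall>l \<in> {1..narrow_class_number \<alpha>}. \<forall>D \<in> double_cosets r1 r2 (\<BB> l).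
                parametrizes r1 r2 (\<BB> 1) (\<BB> l) D m \<nu> \<longleftrightarrow>
                parametrizes r1 r2 (\<BB> 1) (\<BB> l) D m \<mu>)))) \<and>
     (2 \<le> d \<longrightarrow>
       (\<forall>l \<in> {1..narrow_class_number \<alpha>}. \<forall>D \<in> double_cosets r1 r2 (\<BB> l).
        \<forall>\<gamma> \<in> D. \<forall>\<xi> \<in> C_plus r1 r2. \<forall>N \<in> carrier_mat d d.
          (\<forall>i<d. \<forall>j<d - 1. N $$ (i, j) = 1\<^sub>m d $$ (i, j)) \<and>
          cmat \<gamma> * \<BB> l * mat_diag d (\<lambda>j. \<xi> $ j) = N * \<BB> 1 \<longrightarrow>
          (\<exists>m \<mu> :: int. 0 < m \<and> [poly F \<mu> = 0] (mod m) \<and>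
             (\<exists>u \<in> U_group d.
                cmat (u * \<gamma>) * \<BB> l * mat_diag d (\<lambda>j. \<xi> $ j) = cmat (root_mat d m \<mu>) * \<BB> 1) \<and>
             (\<forall>m' \<mu>'. 0 < m' \<and> [poly F \<mu>' = 0] (mod m') \<and>
                parametrizes r1 r2 (\<BB> 1) (\<BB> l) D m' \<mu>' \<longrightarrow>
                m' = m \<and> [\<mu>' = \<mu>] (mod m)) \<and>
             invertible_ideal \<alpha> (root_lattice \<alpha> m \<mu>))))"
proof -
  interpret monogenic_field_places F \<alpha> d r1 r2
    using assms(1-8) by unfold_locales auto
  let ?h = "narrow_class_number \<alpha>"
  have B1: "\<BB> 1 = \<V>"
    unfolding assms(14) by (rule eq_matI) (auto simp: embedding_mat_def assms(13) simp del: One_nat_def)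
  have B: "\<BB> l \<in> carrier_mat d d" for l unfolding assms(14) by simp
  have I: "invertible_fractional_ideal \<alpha> (I l)" if "l \<in> {1..?h}" for l
    using assms(9)[OF that] by (simp add: invertible_ideal_def)
  have sgn: "sgn (det (embedding_mat d (\<beta> l))) = sgn (det \<V>)" if "l \<in> {1..?h}" for l
    using assms(15)[OF that] B1 assms(14) by metis
  have detB: "det (\<BB> l) \<noteq> 0" if "l \<in> {1..?h}" for l
    using sgn[OF that] det_power_basis assms(14) by (metis sgn_zero_iff)
  have basis: "int_span d (\<beta> l) = I l" if "l \<in> {1..?h}" for l
    using assms(12)[OF that] by (auto simp: int_basis_def)
  have parametrizes_iff: "parametrizes r1 r2 (\<BB> 1) (\<BB> l) D m \<mu> \<longleftrightarrow> (\<exists>\<gamma>\<in>D. \<exists>\<xi>\<in>C_plus r1 r2.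
      cmat (root_mat d m \<mu>) * \<V> = cmat \<gamma> * embedding_mat d (\<beta> l) * cdiag d \<xi>)" for l D m \<mu>
    unfolding parametrizes_def Let_def d_eq[symmetric] B1 assms(14)[of l] ..

  have rel: "(I l, root_lattice \<alpha> m \<mu>) \<in> narrow_rel \<alpha>"
    if l: "l \<in> {1..?h}" and D: "D \<in> double_cosets r1 r2 (\<BB> l)" and p: "parametrizes r1 r2 (\<BB> 1) (\<BB> l) D m \<mu>"
      and m: "m > 0" "m dvd poly F \<mu>" for l D m \<mu>
  proof -
    obtain \<gamma> \<xi> where \<gamma>: "\<gamma> \<in> D" "\<xi> \<in> C_plus r1 r2"
      "cmat (root_mat d m \<mu>) * \<V> = cmat \<gamma> * embedding_mat d (\<beta> l) * cdiag d \<xi>"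
      using p unfolding parametrizes_iff by blast
    have "m \<noteq> 0" using m by simp
    then show ?thesis
      using narrow_rel_root_lattice[OF I[OF l] basis[OF l] double_cosets_eq(1)[OF d_eq B detB[OF l] D \<gamma>(1)] \<gamma>(2)
          _ m(2) \<gamma>(3)] by simp
  qed

  have same_coset: "D = D'"
    if l: "l \<in> {1..?h}" and D: "D \<in> double_cosets r1 r2 (\<BB> l)" "D' \<in> double_cosets r1 r2 (\<BB> l)"
      and p: "parametrizes r1 r2 (\<BB> 1) (\<BB> l) D m \<mu>" "parametrizes r1 r2 (\<BB> 1) (\<BB> l) D' m \<mu>"
      and m: "m > 0" for l D D' m \<mu>
  proof -
    note dc = double_cosets_eq[OF d_eq B detB[OF l]]
    obtain \<gamma> \<xi> where \<gamma>: "\<gamma> \<in> D" "\<xi> \<in> C_plus r1 r2"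
      "cmat (root_mat d m \<mu>) * \<V> = cmat \<gamma> * \<BB> l * cdiag d \<xi>"
      using p(1)[unfolded parametrizes_iff, folded assms(14)] by blast
    obtain \<gamma>' \<xi>' where \<gamma>': "\<gamma>' \<in> D'" "\<xi>' \<in> C_plus r1 r2"
      "cmat (root_mat d m \<mu>) * \<V> = cmat \<gamma>' * \<BB> l * cdiag d \<xi>'"
      using p(2)[unfolded parametrizes_iff, folded assms(14)] by blast
    \<comment> \<open>Zeros of \<xi>' at complex places are excluded by the determinant of the
      left-hand side, which is \<open>m\<close> times that of \<V>.\<close>
    have "det (cmat \<gamma>' * \<BB> l * cdiag d \<xi>') \<noteq> 0"
      unfolding \<gamma>'(3)[symmetric] using m det_power_basis d_pos by (simp add: det_mult[of _ d] det_root_mat)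
    then have "\<xi>' $ j \<noteq> 0" if "j < d" for j
      by (rule det_mult_cdiag_nonzero[rotated])
        (use SL_carrier[OF dc(1)[OF D(2) \<gamma>'(1)]] B that in \<open>auto intro: square_mult_carrier[of _ d]\<close>)
    then obtain g where g: "g \<in> unit_group r1 r2 (\<BB> l)" "\<gamma>' = \<gamma> * g"
      using unit_group_coset[OF d_eq B detB[OF l] dc(1)[OF D(1) \<gamma>(1)] dc(1)[OF D(2) \<gamma>'(1)] \<gamma>(2) \<gamma>'(2)] \<gamma>(3) \<gamma>'(3)
      by metis
    have "\<gamma>' = 1\<^sub>m d * \<gamma> * g" using g SL_carrier[OF dc(1)[OF D(1) \<gamma>(1)]] by simp
    then have "\<gamma>' \<in> D" using g(1) one_U_group dc(2)[OF D(1) \<gamma>(1)] by blast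
    \<comment> \<open>Both cosets contain \<gamma>', so both are described from it in the same
      way.\<close>
    then show ?thesis using dc(2)[OF D(1), of \<gamma>'] dc(2)[OF D(2) \<gamma>'(1)] by simp
  qed

  have forward: "\<exists>!(l, D). l \<in> {1..?h} \<and> D \<in> double_cosets r1 r2 (\<BB> l) \<and> parametrizes r1 r2 (\<BB> 1) (\<BB> l) D m \<mu>"
    if m: "0 < m" "m dvd poly F \<mu>" and inv: "invertible_ideal \<alpha> (root_lattice \<alpha> m \<mu>)" for m \<mu>
  proof -
    let ?L = "root_lattice \<alpha> m \<mu>"
    have L: "invertible_fractional_ideal \<alpha> ?L" using inv by (simp add: invertible_ideal_def)
    \<comment> \<open>The ideals \<open>I l\<close> represent every narrow class, which produces
      \<open>l\<close>; injectivity on classes makes it unique below.\<close>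
    have "narrow_rel \<alpha> `` {?L} \<in> (\<lambda>l. narrow_rel \<alpha> `` {I l}) ` {1..?h}"
      unfolding bij_betw_imp_surj_on[OF assms(10)] using L by (auto simp: narrow_classes_def intro: quotientI)
    then obtain l where "narrow_rel \<alpha> `` {?L} = narrow_rel \<alpha> `` {I l}" and l: "l \<in> {1..?h}"
      by (rule imageE)
    then have cls: "narrow_rel \<alpha> `` {I l} = narrow_rel \<alpha> `` {?L}" by simp
    have "(I l, ?L) \<in> narrow_rel \<alpha>" using eq_equiv_class[OF cls equiv_narrow_rel] L by simp
    from narrow_rel_imp_root_mat[OF this basis[OF l] sgn[OF l] m(1)]
    obtain \<gamma> \<xi> where \<gamma>: "\<gamma> \<in> SL d" and \<xi>: "\<xi> \<in> C_plus r1 r2"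
      and eq: "cmat (root_mat d m \<mu>) * \<V> = cmat \<gamma> * embedding_mat d (\<beta> l) * cdiag d \<xi>" by blast
    obtain D where D: "D \<in> double_cosets r1 r2 (\<BB> l)" "\<gamma> \<in> D"
      using double_cosets_mem[OF d_eq B detB[OF l] \<gamma>] by blast
    have p: "parametrizes r1 r2 (\<BB> 1) (\<BB> l) D m \<mu>" unfolding parametrizes_iff using D(2) \<xi> eq by blast
    show ?thesis
    proof (rule ex1I[of _ "(l, D)"])
      fix x assume x: "case x of (l, D) \<Rightarrow> l \<in> {1..?h} \<and> D \<in> double_cosets r1 r2 (\<BB> l) \<and>
        parametrizes r1 r2 (\<BB> 1) (\<BB> l) D m \<mu>"
      obtain l' D' where [simp]: "x = (l', D')" by (cases x)
      have l': "l' \<in> {1..?h}" and D': "D' \<in> double_cosets r1 r2 (\<BB> l')"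
        and p': "parametrizes r1 r2 (\<BB> 1) (\<BB> l') D' m \<mu>" using x by auto
      have "narrow_rel \<alpha> `` {I l'} = narrow_rel \<alpha> `` {?L}"
        by (rule equiv_class_eq[OF equiv_narrow_rel rel[OF l' D' p' m]])
      then have "narrow_rel \<alpha> `` {I l'} = narrow_rel \<alpha> `` {I l}" using cls by simp
      then have "l' = l" using assms(10) l l' by (auto simp: bij_betw_def dest: inj_onD)
      then show "x = (l, D)" using same_coset[OF l D(1) _ p _ m(1)] D' p' by simp
    qed (use l D(1) p in simp)
  qed

  have converse: "\<exists>m \<mu> :: int. 0 < m \<and> [poly F \<mu> = 0] (mod m) \<and>
      (\<exists>u \<in> U_group d. cmat (u * \<gamma>) * \<BB> l * mat_diag d (\<lambda>j. \<xi> $ j) = cmat (root_mat d m \<mu>) * \<BB> 1) \<and>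
      (\<forall>m' \<mu>'. 0 < m' \<and> [poly F \<mu>' = 0] (mod m') \<and> parametrizes r1 r2 (\<BB> 1) (\<BB> l) D m' \<mu>' \<longrightarrow>
         m' = m \<and> [\<mu>' = \<mu>] (mod m)) \<and>
      invertible_ideal \<alpha> (root_lattice \<alpha> m \<mu>)"
    if d2: "2 \<le> d" and l: "l \<in> {1..?h}" and D: "D \<in> double_cosets r1 r2 (\<BB> l)" and \<gamma>: "\<gamma> \<in> D"
      and \<xi>: "\<xi> \<in> C_plus r1 r2" and N: "N \<in> carrier_mat d d"
      and cols: "\<forall>i<d. \<forall>j<d - 1. N $$ (i, j) = 1\<^sub>m d $$ (i, j)"
      and eq: "cmat \<gamma> * \<BB> l * mat_diag d (\<lambda>j. \<xi> $ j) = N * \<BB> 1" for l D \<gamma> \<xi> N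
  proof -
    have cols': "\<And>i j. i < d \<Longrightarrow> j < d - 1 \<Longrightarrow> N $$ (i, j) = 1\<^sub>m d $$ (i, j)" using cols by blast
    have eq': "cmat \<gamma> * embedding_mat d (\<beta> l) * cdiag d \<xi> = N * \<V>" using eq unfolding B1 assms(14)[of l] .
    obtain m \<mu> u where m: "m > 0" "m dvd poly F \<mu>" and u: "u \<in> U_group d"
      and res: "cmat (u * \<gamma>) * embedding_mat d (\<beta> l) * cdiag d \<xi> = cmat (root_mat d m \<mu>) * \<V>"
      using root_mat_of_near_identity[OF d2 I[OF l] basis[OF l] sgn[OF l]
          double_cosets_eq(1)[OF d_eq B detB[OF l] D \<gamma>] \<xi> N cols' eq'] by blast
    \<comment> \<open>The corrected matrix \<open>u * \<gamma>\<close> stays in the coset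
      \<open>D\<close>, so \<mu> belongs to \<open>D\<close> itself.\<close>
    have p: "parametrizes r1 r2 (\<BB> 1) (\<BB> l) D m \<mu>"
      unfolding parametrizes_iff using double_cosets_U_mult[OF d_eq B detB[OF l] D \<gamma> u] \<xi> res[symmetric] by blast
    \<comment> \<open>Invertibility is inherited from \<open>I l\<close>, which lies in the same
      narrow class.\<close>
    have "invertible_ideal \<alpha> (root_lattice \<alpha> m \<mu>)"
      using rel[OF l D p m] ideal_root_lattice[of m \<mu>] m by (simp add: invertible_ideal_def narrow_rel_iff)
    moreover have "m' = m \<and> [\<mu>' = \<mu>] (mod m)" if "parametrizes r1 r2 (\<BB> 1) (\<BB> l) D m' \<mu>'" for m' \<mu>'
      using root_mat_unique[OF d2 B detB[OF l] D _ p[unfolded B1] that[unfolded B1]] m by simp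
    moreover have "cmat (u * \<gamma>) * \<BB> l * mat_diag d (\<lambda>j. \<xi> $ j) = cmat (root_mat d m \<mu>) * \<BB> 1"
      using res unfolding B1 assms(14)[of l] .
    moreover have "[poly F \<mu> = 0] (mod m)" using m(2) by (simp add: cong_0_iff)
    ultimately show ?thesis using m(1) u by blast
  qed

  show ?thesis
  proof (intro conjI allI impI ballI)
    fix m \<mu> :: int
    assume *: "0 < m \<and> [poly F \<mu> = 0] (mod m)"
    then have m: "0 < m" "m \<noteq> 0" "m dvd poly F \<mu>" by (auto simp: cong_0_iff)
    show "ideal (root_lattice \<alpha> m \<mu>) \<O>" by (rule ideal_root_lattice[OF m(2,3)])
    show "cyclic_group (add_monoid (\<O> Quot root_lattice \<alpha> m \<mu>))"
      by (rule cyclic_quotient_root_lattice[OF m(2,3)])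
    assume inv: "invertible_ideal \<alpha> (root_lattice \<alpha> m \<mu>)"
    show "\<exists>!(l, D). l \<in> {1..?h} \<and> D \<in> double_cosets r1 r2 (\<BB> l) \<and> parametrizes r1 r2 (\<BB> 1) (\<BB> l) D m \<mu>"
      by (rule forward[OF m(1,3) inv])
    fix \<nu> l D assume "[\<nu> = \<mu>] (mod m)" and l: "l \<in> {1..?h}" "D \<in> double_cosets r1 r2 (\<BB> l)"
    then show "parametrizes r1 r2 (\<BB> 1) (\<BB> l) D m \<nu> = parametrizes r1 r2 (\<BB> 1) (\<BB> l) D m \<mu>"
      using parametrizes_U_mult[OF d_eq B detB[OF l(1)] B l(2)] cong_sym by blast
  next
    fix l D \<gamma> \<xi> N
    assume "2 \<le> d" "l \<in> {1..?h}" "D \<in> double_cosets r1 r2 (\<BB> l)" "\<gamma> \<in> D" "\<xi> \<in> C_plus r1 r2" "N \<in> carrier_mat d d"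
      "(\<forall>i<d. \<forall>j<d - 1. N $$ (i, j) = 1\<^sub>m d $$ (i, j)) \<and>
        cmat \<gamma> * \<BB> l * mat_diag d (\<lambda>j. \<xi> $ j) = N * \<BB> 1"
    then show "\<exists>m \<mu> :: int. 0 < m \<and> [poly F \<mu> = 0] (mod m) \<and>
      (\<exists>u \<in> U_group d. cmat (u * \<gamma>) * \<BB> l * mat_diag d (\<lambda>j. \<xi> $ j) = cmat (root_mat d m \<mu>) * \<BB> 1) \<and>
      (\<forall>m' \<mu>'. 0 < m' \<and> [poly F \<mu>' = 0] (mod m') \<and> parametrizes r1 r2 (\<BB> 1) (\<BB> l) D m' \<mu>' \<longrightarrow>
         m' = m \<and> [\<mu>' = \<mu>] (mod m)) \<and>
      invertible_ideal \<alpha> (root_lattice \<alpha> m \<mu>)"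
      using converse by blast
  qed
qed

end
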